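(* Let $n\ge 2$. 1. The ideal $\mathfrak{u}_{n,2}=\sum_{j=2}^nP_{j-1}\partial_j$ is the largest proper ideal of the Lie algebra $\mathfrak{u}_n$. 2. The ideal $\mathfrak{u}_{n,2}$ is the only proper co-finite ideal of $\mathfrak{u}_n$, and $\dim_K(\mathfrak{u}_n/\mathfrak{u}_{n,2})=1$. 3. The centre $Z(\mathfrak{u}_n)=K\partial_n$ of $\mathfrak{u}_n$ is the least nonzero ideal of $\mathfrak{u}_n$. 4. The ideals $I_s:=\sum_{i=0}^{s-1}Kx_1^i\partial_n$, $s=1,2,\ldots$, are the only nonzero finite dimensional ideals of $\mathfrak{u}_n$, and $\dim_K(I_s)=s$.
   Context: $K$ is a field of characteristic zero, $P_0=K$, $P_i=K[x_1,\ldots,x_i]$, $\partial_i=\partial/\partial x_i$. For $n\ge 2$, $\mathfrak{u}_n=K\partial_1+P_1\partial_2+\cdots+P_{n-1}\partial_n$, a Lie subalgebra of $\mathrm{Der}_K(P_n)$. An ideal $\mathfrak{a}$ of a Lie algebra $\mathcal{G}$ is called proper if $\mathfrak{a}\ne 0$ and $\mathfrak{a}\ne\mathcal{G}$, and co-finite if $\dim_K(\mathcal{G}/\mathfrak{a})<\infty$. *)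

theory Defs
  imports "HOL-Library.Poly_Mapping" "HOL-Algebra.AbelCoset" "Jordan_Normal_Form.VS_Connect"
begin

section \<open>Lie algebras\<close>

text \<open>The ring multiplication and unit inherited from \<^typ>\<open>('a, 'b) module\<close> play no role
  and are left \<^term>\<open>undefined\<close> below.\<close>

record ('a, 'b) lie_alg = "('a, 'b) module" +
  lbrack :: "'b \<Rightarrow> 'b \<Rightarrow> 'b"

locale lie_algebra = vectorspace K L
  for K :: "('a, 'c) ring_scheme" and L :: "('a, 'b, 'd) lie_alg_scheme" (structure) +
  assumes lbrack_closed: "x \<in> carrier L \<Longrightarrow> y \<in> carrier L \<Longrightarrow> lbrack L x y \<in> carrier L"
    and lbrack_add_left: "x \<in> carrier L \<Longrightarrow> y \<in> carrier L \<Longrightarrow> z \<in> carrier L \<Longrightarrow>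
      lbrack L (x \<oplus>\<^bsub>L\<^esub> y) z = lbrack L x z \<oplus>\<^bsub>L\<^esub> lbrack L y z"
    and lbrack_add_right: "x \<in> carrier L \<Longrightarrow> y \<in> carrier L \<Longrightarrow> z \<in> carrier L \<Longrightarrow>
      lbrack L x (y \<oplus>\<^bsub>L\<^esub> z) = lbrack L x y \<oplus>\<^bsub>L\<^esub> lbrack L x z"
    and lbrack_smult_left: "c \<in> carrier K \<Longrightarrow> x \<in> carrier L \<Longrightarrow> y \<in> carrier L \<Longrightarrow>
      lbrack L (c \<odot>\<^bsub>L\<^esub> x) y = c \<odot>\<^bsub>L\<^esub> lbrack L x y"
    and lbrack_smult_right: "c \<in> carrier K \<Longrightarrow> x \<in> carrier L \<Longrightarrow> y \<in> carrier L \<Longrightarrow>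
      lbrack L x (c \<odot>\<^bsub>L\<^esub> y) = c \<odot>\<^bsub>L\<^esub> lbrack L x y"
    and lbrack_self: "x \<in> carrier L \<Longrightarrow> lbrack L x x = \<zero>\<^bsub>L\<^esub>"
    and jacobi: "x \<in> carrier L \<Longrightarrow> y \<in> carrier L \<Longrightarrow> z \<in> carrier L \<Longrightarrow>
      lbrack L x (lbrack L y z) \<oplus>\<^bsub>L\<^esub> (lbrack L y (lbrack L z x) \<oplus>\<^bsub>L\<^esub> lbrack L z (lbrack L x y)) = \<zero>\<^bsub>L\<^esub>"

definition lie_ideal :: "('a, 'c) ring_scheme \<Rightarrow> ('a, 'b, 'd) lie_alg_scheme \<Rightarrow> 'b set \<Rightarrow> bool" where
  "lie_ideal K L I \<longleftrightarrow> submodule K I L \<and> (\<forall>x\<in>carrier L. \<forall>y\<in>I. lbrack L x y \<in> I)"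

definition proper_lie_ideal :: "('a, 'c) ring_scheme \<Rightarrow> ('a, 'b, 'd) lie_alg_scheme \<Rightarrow> 'b set \<Rightarrow> bool" where
  "proper_lie_ideal K L I \<longleftrightarrow> lie_ideal K L I \<and> I \<noteq> {\<zero>\<^bsub>L\<^esub>} \<and> I \<noteq> carrier L"

definition lie_centre :: "('a, 'b, 'd) lie_alg_scheme \<Rightarrow> 'b set" where
  "lie_centre L = {z \<in> carrier L. \<forall>x\<in>carrier L. lbrack L z x = \<zero>\<^bsub>L\<^esub>}"

text \<open>The quotient vector space \<open>V/W\<close>, whose elements are the cosets of \<open>W\<close>. In the scalar
  multiplication, adding \<open>W\<close> turns the set \<open>c(x + W)\<close> into the coset \<open>cx + W\<close> also when \<open>c = 0\<close>.\<close>

definition quot_vs :: "('a, 'b, 'd) module_scheme \<Rightarrow> 'b set \<Rightarrow> ('a, 'b set) module" where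
  "quot_vs V W = \<lparr>carrier = a_rcosets\<^bsub>V\<^esub> W, mult = undefined, one = undefined, zero = W,
     add = set_add V, smult = (\<lambda>c X. W <+>\<^bsub>V\<^esub> (smult V c ` X))\<rparr>"

lemma vectorspace_quot:
  fixes K :: "('a, 'c) ring_scheme" and V :: "('a, 'b, 'd) module_scheme"
  assumes V: "vectorspace K V" and W: "submodule K W V"
  shows "vectorspace K (quot_vs V W)"
proof -
  interpret V: vectorspace K V by (rule V)
  interpret W: submodule K W V by (rule W)
  have neg: "\<ominus>\<^bsub>V\<^esub> x \<in> W" if "x \<in> W" for x
    using that W.smult_closed[of "\<ominus>\<^bsub>K\<^esub> \<one>\<^bsub>K\<^esub>" x] W.subset
    by (metis V.R.add.inv_closed V.R.one_closed V.smult_l_minus V.smult_one subsetD)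
  have "additive_subgroup W V"
    using W.subset neg
    by (intro additive_subgroup.intro V.add.subgroupI) (auto simp: a_inv_def[symmetric] intro: W.zero_closed)
  then interpret S: abelian_subgroup W V
    by (rule abelian_subgroupI3) (rule V.M.abelian_group_axioms)
  have add: "(W +>\<^bsub>V\<^esub> x) <+>\<^bsub>V\<^esub> (W +>\<^bsub>V\<^esub> y) = W +>\<^bsub>V\<^esub> (x \<oplus>\<^bsub>V\<^esub> y)"
    if "x \<in> carrier V" "y \<in> carrier V" for x y
    using that by (rule S.a_rcos_sum)
  have scal: "W <+>\<^bsub>V\<^esub> ((\<odot>\<^bsub>V\<^esub>) c ` (W +>\<^bsub>V\<^esub> x)) = W +>\<^bsub>V\<^esub> (c \<odot>\<^bsub>V\<^esub> x)"
    if c: "c \<in> carrier K" and x: "x \<in> carrier V" for c x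
  proof (intro equalityI subsetI)
    fix y assume "y \<in> W <+>\<^bsub>V\<^esub> ((\<odot>\<^bsub>V\<^esub>) c ` (W +>\<^bsub>V\<^esub> x))"
    then obtain w w' where "w \<in> W" "w' \<in> W" "y = w \<oplus>\<^bsub>V\<^esub> c \<odot>\<^bsub>V\<^esub> (w' \<oplus>\<^bsub>V\<^esub> x)"
      by (auto simp: set_add_def' a_r_coset_def')
    moreover from this have "y = (w \<oplus>\<^bsub>V\<^esub> c \<odot>\<^bsub>V\<^esub> w') \<oplus>\<^bsub>V\<^esub> c \<odot>\<^bsub>V\<^esub> x"
      using c x W.subset by (auto simp: V.smult_r_distr V.M.add.m_assoc subset_iff)
    ultimately show "y \<in> W +>\<^bsub>V\<^esub> (c \<odot>\<^bsub>V\<^esub> x)"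
      using c by (auto simp: a_r_coset_def' intro!: bexI[of _ "w \<oplus>\<^bsub>V\<^esub> c \<odot>\<^bsub>V\<^esub> w'"])
  next
    fix y assume "y \<in> W +>\<^bsub>V\<^esub> (c \<odot>\<^bsub>V\<^esub> x)"
    then obtain w where w: "w \<in> W" "y = w \<oplus>\<^bsub>V\<^esub> c \<odot>\<^bsub>V\<^esub> x" by (auto simp: a_r_coset_def')
    have "x \<in> W +>\<^bsub>V\<^esub> x" using x by (rule S.a_rcos_self)
    with w show "y \<in> W <+>\<^bsub>V\<^esub> ((\<odot>\<^bsub>V\<^esub>) c ` (W +>\<^bsub>V\<^esub> x))" by (auto simp: set_add_def')
  qed
  have cosE: "\<exists>x\<in>carrier V. X = W +>\<^bsub>V\<^esub> x" if "X \<in> a_rcosets\<^bsub>V\<^esub> W" for X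
    using that by (auto simp: A_RCOSETS_def')
  have cosI: "W +>\<^bsub>V\<^esub> x \<in> a_rcosets\<^bsub>V\<^esub> W" if "x \<in> carrier V" for x
    using that by (auto simp: A_RCOSETS_def')
  have W0: "W = W +>\<^bsub>V\<^esub> \<zero>\<^bsub>V\<^esub>" using W.subset by (force simp: a_r_coset_def')
  show ?thesis
  proof (intro vectorspace.intro moduleI)
    show "abelian_group (quot_vs V W)"
    proof (rule abelian_groupI; unfold quot_vs_def, simp)
      fix X Y assume "X \<in> a_rcosets\<^bsub>V\<^esub> W" "Y \<in> a_rcosets\<^bsub>V\<^esub> W"
      then show "X <+>\<^bsub>V\<^esub> Y \<in> a_rcosets\<^bsub>V\<^esub> W" by (auto dest!: cosE simp: add cosI)
    next
      show "W \<in> a_rcosets\<^bsub>V\<^esub> W" using W0 cosI by (metis V.M.zero_closed)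
    next
      fix X Y Z assume "X \<in> a_rcosets\<^bsub>V\<^esub> W" "Y \<in> a_rcosets\<^bsub>V\<^esub> W" "Z \<in> a_rcosets\<^bsub>V\<^esub> W"
      then show "X <+>\<^bsub>V\<^esub> Y <+>\<^bsub>V\<^esub> Z = X <+>\<^bsub>V\<^esub> (Y <+>\<^bsub>V\<^esub> Z)"
        by (auto dest!: cosE simp: add V.M.add.m_assoc)
    next
      fix X Y assume "X \<in> a_rcosets\<^bsub>V\<^esub> W" "Y \<in> a_rcosets\<^bsub>V\<^esub> W"
      then show "X <+>\<^bsub>V\<^esub> Y = Y <+>\<^bsub>V\<^esub> X" by (auto dest!: cosE simp: add V.M.add.m_comm)
    next
      fix X assume "X \<in> a_rcosets\<^bsub>V\<^esub> W"
      then obtain x where x: "x \<in> carrier V" "X = W +>\<^bsub>V\<^esub> x" using cosE by blast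
      then show "W <+>\<^bsub>V\<^esub> X = X" using add[of "\<zero>\<^bsub>V\<^esub>" x] W0 by simp
      show "\<exists>Y\<in>a_rcosets\<^bsub>V\<^esub> W. Y <+>\<^bsub>V\<^esub> X = W"
        using x cosI[of "\<ominus>\<^bsub>V\<^esub> x"] add[of "\<ominus>\<^bsub>V\<^esub> x" x] W0
        by (auto simp: V.M.l_neg intro!: bexI[of _ "W +>\<^bsub>V\<^esub> (\<ominus>\<^bsub>V\<^esub> x)"])
    qed
  qed (auto simp: quot_vs_def scal add cosI V.R.is_cring V.smult_l_distr V.smult_r_distr V.smult_assoc1 
      dest!: cosE intro: V.field.field_axioms V.R.cring_axioms)
qed

definition cofinite_in :: "('a, 'c) ring_scheme \<Rightarrow> ('a, 'b, 'd) module_scheme \<Rightarrow> 'b set \<Rightarrow> bool" where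
  "cofinite_in K V W \<longleftrightarrow> vectorspace.fin_dim K (quot_vs V W)"

definition finite_dim_in :: "('a, 'c) ring_scheme \<Rightarrow> ('a, 'b, 'd) module_scheme \<Rightarrow> 'b set \<Rightarrow> bool" where
  "finite_dim_in K V W \<longleftrightarrow> vectorspace.fin_dim K (V\<lparr>carrier := W\<rparr>)"


section \<open>Polynomials and derivations\<close>

text \<open>Polynomials in \<open>x\<^sub>0, x\<^sub>1, x\<^sub>2, \<dots>\<close>: finitely supported maps from exponent vectors to coefficients;
  the multiplication of \<^typ>\<open>'a \<Rightarrow>\<^sub>0 'b\<close> is convolution.
  The variable \<open>x\<^sub>0\<close> is never used.\<close>

type_synonym 'a mpoly = "(nat \<Rightarrow>\<^sub>0 nat) \<Rightarrow>\<^sub>0 'a"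

abbreviation Const :: "'a::zero \<Rightarrow> 'a mpoly" where
  "Const c \<equiv> Poly_Mapping.single 0 c"

abbreviation Var :: "nat \<Rightarrow> 'a::zero_neq_one mpoly" where
  "Var i \<equiv> Poly_Mapping.single (Poly_Mapping.single i 1) 1"

text \<open>\<open>polys i\<close> is \<open>P\<^sub>i = K[x\<^sub>1, \<dots>, x\<^sub>i]\<close>.\<close>

definition polys :: "nat \<Rightarrow> 'a::zero mpoly set" where
  "polys i = {f. \<forall>m\<in>Poly_Mapping.keys f. Poly_Mapping.keys m \<subseteq> {1..i}}"

text \<open>The truncated subtraction of exponents is harmless: if \<open>x\<^sub>i\<close> does not
  occur in the monomial \<open>m\<close>, the coefficient is zero.\<close>

definition pdiff :: "nat \<Rightarrow> 'a::comm_semiring_1 mpoly \<Rightarrow> 'a mpoly" where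
  "pdiff i f = (\<Sum>m\<in>Poly_Mapping.keys f.
     Poly_Mapping.single (m - Poly_Mapping.single i 1)
       (of_nat (Poly_Mapping.lookup m i) * Poly_Mapping.lookup f m))"

lemma polys_0: "0 \<in> polys n" by (simp add: polys_def)

lemma polys_add: "f \<in> polys n \<Longrightarrow> g \<in> polys n \<Longrightarrow> f + g \<in> polys n"
  for f :: "'a::comm_ring_1 mpoly"
  using Poly_Mapping.keys_add[of f g] by (fastforce simp: polys_def)

lemma polys_uminus: "f \<in> polys n \<Longrightarrow> - f \<in> polys n"
  for f :: "'a::comm_ring_1 mpoly"
  by (simp add: polys_def)

lemma polys_diff: "f \<in> polys n \<Longrightarrow> g \<in> polys n \<Longrightarrow> f - g \<in> polys n"
  for f :: "'a::comm_ring_1 mpoly"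
  using polys_add[of f n "-g"] by (simp add: polys_uminus)

lemma polys_mult: "f \<in> polys n \<Longrightarrow> g \<in> polys n \<Longrightarrow> f * g \<in> polys n"
  for f :: "'a::comm_ring_1 mpoly"
proof -
  assume fg: "f \<in> polys n" "g \<in> polys n"
  { fix m assume "m \<in> Poly_Mapping.keys (f * g)"
    then obtain a b where "m = a + b" "a \<in> Poly_Mapping.keys f" "b \<in> Poly_Mapping.keys g"
      using keys_mult[of f g] by blast
    then have "Poly_Mapping.keys m \<subseteq> {1..n}"
      using fg Poly_Mapping.keys_add[of a b] by (fastforce simp: polys_def) }
  then show ?thesis by (simp add: polys_def)
qed

lemma polys_sum: "(\<And>i. i \<in> A \<Longrightarrow> f i \<in> polys n) \<Longrightarrow> (\<Sum>i\<in>A. f i) \<in> polys n"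
  for f :: "'b \<Rightarrow> 'a::comm_ring_1 mpoly"
  by (induction A rule: infinite_finite_induct) (auto simp: polys_0 polys_add)

lemma polys_Const: "Const c \<in> polys n" by (simp add: polys_def)

lemma polys_mono: "i \<le> j \<Longrightarrow> polys i \<subseteq> polys j"
  by (fastforce simp: polys_def)

lemma pdiff_superset:
  assumes "finite A" "Poly_Mapping.keys f \<subseteq> A"
  shows "pdiff i f = (\<Sum>m\<in>A. Poly_Mapping.single (m - Poly_Mapping.single i 1)
       (of_nat (Poly_Mapping.lookup m i) * Poly_Mapping.lookup f m))"
  unfolding pdiff_def
  by (rule sum.mono_neutral_left[OF assms]) (auto simp: in_keys_iff)

lemma pdiff_0 [simp]: "pdiff i 0 = 0" by (simp add: pdiff_def)

lemma pdiff_add: "pdiff i (f + g) = pdiff i f + pdiff i g"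
proof -
  let ?A = "Poly_Mapping.keys f \<union> Poly_Mapping.keys g"
  have "finite ?A" by simp
  moreover have "Poly_Mapping.keys (f + g) \<subseteq> ?A" by (rule Poly_Mapping.keys_add)
  ultimately show ?thesis
    by (simp add: pdiff_superset[of ?A] lookup_add ring_distribs distrib_left single_add sum.distrib)
qed

lemma pdiff_single: "pdiff i (Poly_Mapping.single m c) =
    Poly_Mapping.single (m - Poly_Mapping.single i 1) (of_nat (Poly_Mapping.lookup m i) * c)"
  by (subst pdiff_superset[of "{m}"]) auto

lemma poly_sum_singles: "(\<Sum>m\<in>Poly_Mapping.keys f. Poly_Mapping.single m (Poly_Mapping.lookup f m)) = f"
  by (rule poly_mapping_eqI) (simp add: lookup_sum lookup_single when_def in_keys_iff)

lemma pdiff_sum: "pdiff i (\<Sum>x\<in>A. f x) = (\<Sum>x\<in>A. pdiff i (f x))"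
  by (induction A rule: infinite_finite_induct) (auto simp: pdiff_add)

lemma exp_shift: "Poly_Mapping.lookup m i \<noteq> 0 \<Longrightarrow>
   (m + k) - Poly_Mapping.single i (1::nat) = (m - Poly_Mapping.single i 1) + k" for m k :: "nat \<Rightarrow>\<^sub>0 nat"
  by (rule poly_mapping_eqI) (auto simp: lookup_add lookup_minus lookup_single when_def)

lemma pdiff_mult_single:
  "pdiff i (Poly_Mapping.single m a * Poly_Mapping.single k b) =
   pdiff i (Poly_Mapping.single m a) * Poly_Mapping.single k b + Poly_Mapping.single m a * pdiff i (Poly_Mapping.single k b)"
  for a b :: "'a::comm_semiring_1"
proof -
  have 1: "Poly_Mapping.single ((m + k) - Poly_Mapping.single i 1) (of_nat (Poly_Mapping.lookup m i) * (a * b)) =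
     Poly_Mapping.single ((m - Poly_Mapping.single i 1) + k) (of_nat (Poly_Mapping.lookup m i) * (a * b))"
    using exp_shift[of m i k] by (cases "Poly_Mapping.lookup m i = 0") simp_all
  have 2: "Poly_Mapping.single ((m + k) - Poly_Mapping.single i 1) (of_nat (Poly_Mapping.lookup k i) * (a * b)) =
     Poly_Mapping.single (m + (k - Poly_Mapping.single i 1)) (of_nat (Poly_Mapping.lookup k i) * (a * b))"
    using exp_shift[of k i m] by (cases "Poly_Mapping.lookup k i = 0") (simp_all add: add.commute)
  show ?thesis
    using 1 2 by (simp add: pdiff_single mult_single lookup_add ring_distribs distrib_right single_add ac_simps)
qed

lemma pdiff_mult: "pdiff i (f * g) = pdiff i f * g + f * pdiff i g"
  for f g :: "'a::comm_semiring_1 mpoly"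
proof -
  define s where "s h m = Poly_Mapping.single m (Poly_Mapping.lookup h m)" for h :: "'a mpoly" and m
  have f: "f = (\<Sum>m\<in>Poly_Mapping.keys f. s f m)" and g: "g = (\<Sum>m\<in>Poly_Mapping.keys g. s g m)"
    by (simp_all add: s_def poly_sum_singles)
  have *: "pdiff i (s f m * s g k) = pdiff i (s f m) * s g k + s f m * pdiff i (s g k)" for m k
    by (simp add: s_def pdiff_mult_single)
  define F where "F = Poly_Mapping.keys f"
  define G where "G = Poly_Mapping.keys g"
  have f: "f = sum (s f) F" and g: "g = sum (s g) G" using f g by (simp_all add: F_def G_def)
  have "pdiff i (sum (s f) F * sum (s g) G) = pdiff i (sum (s f) F) * sum (s g) G + sum (s f) F * pdiff i (sum (s g) G)"
    by (simp add: sum_product pdiff_sum * sum.distrib)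
  then show ?thesis using f g by simp
qed

lemma pdiff_Const_mult: "pdiff i (Const c * f) = Const c * pdiff i f"
  for f :: "'a::comm_semiring_1 mpoly"
  by (simp add: pdiff_mult pdiff_single)

lemma pdiff_polys: "f \<in> polys n \<Longrightarrow> pdiff i f \<in> polys n" for f :: "'a::comm_ring_1 mpoly"
  unfolding pdiff_def
proof (rule polys_sum)
  fix m assume "f \<in> polys n" "m \<in> Poly_Mapping.keys f"
  moreover have "Poly_Mapping.keys (m - Poly_Mapping.single i 1) \<subseteq> Poly_Mapping.keys m"
    by (auto simp: in_keys_iff lookup_minus)
  ultimately show "Poly_Mapping.single (m - Poly_Mapping.single i 1)
       (of_nat (Poly_Mapping.lookup m i) * Poly_Mapping.lookup f m) \<in> polys n"
    by (fastforce simp: polys_def)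
qed

lemma pdiff_eq_0: "f \<in> polys n \<Longrightarrow> n < i \<Longrightarrow> pdiff i f = 0" for f :: "'a::comm_ring_1 mpoly"
  unfolding pdiff_def
proof (rule sum.neutral, intro ballI)
  fix m assume "f \<in> polys n" "n < i" "m \<in> Poly_Mapping.keys f"
  then have "i \<notin> Poly_Mapping.keys m" by (fastforce simp: polys_def)
  then show "Poly_Mapping.single (m - Poly_Mapping.single i 1)
       (of_nat (Poly_Mapping.lookup m i) * Poly_Mapping.lookup f m) = 0"
    by (simp add: in_keys_iff)
qed

lemma pdiff_commute: "pdiff i (pdiff j f) = pdiff j (pdiff i f)" for f :: "'a::comm_semiring_1 mpoly"
proof (cases "i = j")
  case False
  have "m - Poly_Mapping.single i 1 - Poly_Mapping.single j 1 = m - Poly_Mapping.single j 1 - Poly_Mapping.single i (1::nat)" 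
    for m :: "nat \<Rightarrow>\<^sub>0 nat"
    by (rule poly_mapping_eqI) (auto simp: lookup_minus)
  with False show ?thesis
    unfolding pdiff_def[of _ f]
    by (simp add: pdiff_sum pdiff_single lookup_minus lookup_single when_def ac_simps)
qed simp

text \<open>A derivation of \<open>P\<^sub>n\<close> is represented by a function on the whole polynomial type that vanishes
  outside \<open>P\<^sub>n\<close>, so that it is determined by its restriction to \<open>P\<^sub>n\<close>. The pointwise
  operations preserve this convention.\<close>

definition derivations :: "nat \<Rightarrow> ('a::comm_ring_1 mpoly \<Rightarrow> 'a mpoly) set" where
  "derivations n = {D.
     (\<forall>f\<in>polys n. D f \<in> polys n) \<and> (\<forall>f. f \<notin> polys n \<longrightarrow> D f = 0) \<and>
     (\<forall>f\<in>polys n. \<forall>g\<in>polys n. D (f + g) = D f + D g) \<and>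
     (\<forall>c. \<forall>f\<in>polys n. D (Const c * f) = Const c * D f) \<and>
     (\<forall>f\<in>polys n. \<forall>g\<in>polys n. D (f * g) = D f * g + f * D g)}"

definition Der :: "nat \<Rightarrow> ('a::comm_ring_1, 'a mpoly \<Rightarrow> 'a mpoly) lie_alg" where
  "Der n = \<lparr>carrier = derivations n, mult = undefined, one = undefined,
     zero = (\<lambda>f. 0), add = (\<lambda>D E f. D f + E f), smult = (\<lambda>c D f. Const c * D f),
     lbrack = (\<lambda>D E f. D (E f) - E (D f))\<rparr>"

lemma module_Der: "module class_ring (Der n :: ('a::field, _) lie_alg)"
proof (rule moduleI)
  show "cring (class_ring :: 'a ring)"
    using class_field by (meson field_def domain_def)
  show "abelian_group (Der n :: ('a::field, _) lie_alg)"
  proof (rule abelian_groupI)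
    fix x :: "'a mpoly \<Rightarrow> 'a mpoly" assume x: "x \<in> carrier (Der n)"
    show "\<exists>y\<in>carrier (Der n). y \<oplus>\<^bsub>Der n\<^esub> x = \<zero>\<^bsub>Der n\<^esub>"
    proof (rule bexI[of _ "\<lambda>f. - x f"])
      show "(\<lambda>f. - x f) \<in> carrier (Der n)" using x
        by (auto simp: Der_def derivations_def polys_uminus)
    qed (simp add: Der_def)
  qed (auto simp: Der_def derivations_def polys_add polys_0 algebra_simps)
next
  have Const_mult: "Const (a * b) = Const a * Const b" for a b :: 'a
    by (simp add: mult_single)
  show "(a \<otimes>\<^bsub>class_ring\<^esub> b) \<odot>\<^bsub>Der n\<^esub> x = a \<odot>\<^bsub>Der n\<^esub> (b \<odot>\<^bsub>Der n\<^esub> x)"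
    for a b :: 'a and x
    by (simp add: Der_def Const_mult mult.assoc)
  show "c \<odot>\<^bsub>Der n\<^esub> x \<in> carrier (Der n)" if "x \<in> carrier (Der n)" for c :: 'a and x
    using that by (auto simp: Der_def derivations_def polys_mult polys_Const algebra_simps)
qed (auto simp: Der_def single_add algebra_simps)

lemma lie_algebra_Der: "lie_algebra class_ring (Der n :: ('a::field, _) lie_alg)"
proof -
  have minus: "D (f - g) = D f - D g" if "D \<in> derivations n" "f \<in> polys n" "g \<in> polys n" for D and f g :: "'a mpoly"
  proof -
    have "D (f - g + g) = D (f - g) + D g" using that polys_diff[of f n g] unfolding derivations_def by blast
    then show ?thesis by simp
  qed
  have in_p: "D f \<in> polys n" if "D \<in> derivations n" for D and f :: "'a mpoly"
    using that polys_0 by (cases "f \<in> polys n") (auto simp: derivations_def)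
  have ext: "D f = 0" if "D \<in> derivations n" "f \<notin> polys n" for D and f :: "'a mpoly"
    using that by (auto simp: derivations_def)
  have add: "D (f + g) = D f + D g" if "D \<in> derivations n" "f \<in> polys n" "g \<in> polys n" for D and f g :: "'a mpoly"
    using that by (auto simp: derivations_def)
  have cm: "D (Const c * f) = Const c * D f" if "D \<in> derivations n" "f \<in> polys n" for D c and f :: "'a mpoly"
    using that by (auto simp: derivations_def)
  have cm': "D (f * Const c) = D f * Const c" if "D \<in> derivations n" "f \<in> polys n" for D c and f :: "'a mpoly"
    using cm[OF that] by (simp add: mult.commute)
  have mult: "D (f * g) = D f * g + f * D g" if "D \<in> derivations n" "f \<in> polys n" "g \<in> polys n" for D and f g :: "'a mpoly"
    using that by (auto simp: derivations_def)
  have z: "D 0 = 0" if "D \<in> derivations n" for D :: "'a mpoly \<Rightarrow> 'a mpoly"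
    using minus[OF that polys_0 polys_0] by simp
  have cl: "(\<lambda>f. D (E f) - E (D f)) \<in> derivations n" if "D \<in> derivations n" "E \<in> derivations n" for D E :: "'a mpoly \<Rightarrow> 'a mpoly"
  proof -
    have "\<forall>f\<in>polys n. \<forall>g\<in>polys n. D (E (f * g)) - E (D (f * g)) = (D (E f) - E (D f)) * g + f * (D (E g) - E (D g))"
      using that by (auto simp: in_p add mult polys_mult algebra_simps)
    moreover have "\<forall>c. \<forall>f\<in>polys n. D (E (Const c * f)) - E (D (Const c * f)) = Const c * (D (E f) - E (D f))"
      using that by (auto simp: in_p cm right_diff_distrib)
    ultimately show ?thesis
      unfolding derivations_def using that
      by (auto simp: ext z in_p polys_diff add polys_add)
  qed
  show ?thesis
  proof (intro lie_algebra.intro vectorspace.intro module_Der class_field lie_algebra_axioms.intro)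
    fix x y z :: "'a mpoly \<Rightarrow> 'a mpoly" and c :: 'a
    assume x: "x \<in> carrier (Der n)"
    then have x: "x \<in> derivations n" by (simp add: Der_def)
    note X = minus[OF x in_p in_p] add[OF x in_p in_p] cm[OF x in_p]
    show "lbrack (Der n) x x = \<zero>\<^bsub>Der n\<^esub>" by (simp add: Der_def)
    assume y: "y \<in> carrier (Der n)"
    then have y: "y \<in> derivations n" by (simp add: Der_def)
    note Y = minus[OF y in_p in_p] add[OF y in_p in_p] cm[OF y in_p]
    show "lbrack (Der n) x y \<in> carrier (Der n)" using cl[OF x y] by (simp add: Der_def)
    show "lbrack (Der n) (c \<odot>\<^bsub>Der n\<^esub> x) y = c \<odot>\<^bsub>Der n\<^esub> lbrack (Der n) x y"
      by (simp add: Der_def cm[OF y in_p[OF x]] right_diff_distrib)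
    show "lbrack (Der n) x (c \<odot>\<^bsub>Der n\<^esub> y) = c \<odot>\<^bsub>Der n\<^esub> lbrack (Der n) x y"
      by (simp add: Der_def cm[OF x in_p[OF y]] right_diff_distrib)
    assume z: "z \<in> carrier (Der n)"
    then have z: "z \<in> derivations n" by (simp add: Der_def)
    note Z = minus[OF z in_p in_p] add[OF z in_p in_p]
    show "lbrack (Der n) (x \<oplus>\<^bsub>Der n\<^esub> y) z = lbrack (Der n) x z \<oplus>\<^bsub>Der n\<^esub> lbrack (Der n) y z"
      by (simp add: Der_def add[OF z in_p[OF x] in_p[OF y]] algebra_simps)
    show "lbrack (Der n) x (y \<oplus>\<^bsub>Der n\<^esub> z) = lbrack (Der n) x y \<oplus>\<^bsub>Der n\<^esub> lbrack (Der n) x z"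
      by (simp add: Der_def add[OF x in_p[OF y] in_p[OF z]] algebra_simps)
    show "lbrack (Der n) x (lbrack (Der n) y z) \<oplus>\<^bsub>Der n\<^esub> (lbrack (Der n) y (lbrack (Der n) z x)
        \<oplus>\<^bsub>Der n\<^esub> lbrack (Der n) z (lbrack (Der n) x y)) = \<zero>\<^bsub>Der n\<^esub>"
      by (simp add: Der_def X(1)[OF y z] X(1)[OF z y] Y(1)[OF z x] Y(1)[OF x z] Z(1)[OF x y] Z(1)[OF y x])
  qed
qed

text \<open>\<open>\<partial> n i\<close> is \<open>\<partial>\<^sub>i\<close> as a derivation of \<open>P\<^sub>n\<close>.\<close>

definition partial :: "nat \<Rightarrow> nat \<Rightarrow> 'a::comm_ring_1 mpoly \<Rightarrow> 'a mpoly" (\<open>\<partial>\<close>) where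
  "\<partial> n i = (\<lambda>f. if f \<in> polys n then pdiff i f else 0)"

text \<open>\<open>u_sub n i\<close> is \<open>P\<^bsub>i-1\<^esub>\<partial>\<^sub>i + \<cdots> + P\<^bsub>n-1\<^esub>\<partial>\<^sub>n\<close>.\<close>

definition u_sub :: "nat \<Rightarrow> nat \<Rightarrow> ('a::comm_ring_1 mpoly \<Rightarrow> 'a mpoly) set" where
  "u_sub n i = {\<lambda>f. \<Sum>j=i..n. p j * \<partial> n j f | p. \<forall>j\<in>{i..n}. p j \<in> polys (j - 1)}"

lemma u_sub_subset: "u_sub n i \<subseteq> derivations n"
proof
  fix D :: "'a mpoly \<Rightarrow> 'a mpoly" assume "D \<in> u_sub n i"
  then obtain p where D: "D = (\<lambda>f. \<Sum>j=i..n. p j * \<partial> n j f)" and p: "\<And>j. j \<in> {i..n} \<Longrightarrow> p j \<in> polys (j - 1)"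
    unfolding u_sub_def by blast
  have p: "p j \<in> polys n" if "j \<in> {i..n}" for j
    using p[OF that] polys_mono[of "j - 1" n] that by (meson atLeastAtMost_iff diff_le_self order_trans subsetD)
  show "D \<in> derivations n"
    unfolding derivations_def D
    by (auto intro!: polys_sum polys_mult p pdiff_polys simp: polys_0 partial_def polys_add polys_mult polys_Const
      pdiff_add pdiff_mult pdiff_single algebra_simps sum.distrib sum_distrib_left)
qed

lemma submodule_u: "submodule class_ring (u_sub n i) (Der n :: ('a::field, _) lie_alg)"
proof (rule submodule.intro)
  show "u_sub n i \<subseteq> carrier (Der n)" using u_sub_subset by (simp add: Der_def)
  show "module class_ring (Der n :: ('a::field, _) lie_alg)" by (rule module_Der)
next
  fix v w :: "'a mpoly \<Rightarrow> 'a mpoly" assume "v \<in> u_sub n i" "w \<in> u_sub n i"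
  then obtain p q where "v = (\<lambda>f. \<Sum>j=i..n. p j * \<partial> n j f)" "\<forall>j\<in>{i..n}. p j \<in> polys (j - 1)"
     "w = (\<lambda>f. \<Sum>j=i..n. q j * \<partial> n j f)" "\<forall>j\<in>{i..n}. q j \<in> polys (j - 1)"
    unfolding u_sub_def by blast
  then show "v \<oplus>\<^bsub>Der n\<^esub> w \<in> u_sub n i" unfolding u_sub_def
    by (auto simp: Der_def intro!: exI[of _ "\<lambda>j. p j + q j"] polys_add simp: distrib_right sum.distrib)
next
  show "\<zero>\<^bsub>Der n\<^esub> \<in> u_sub n i" unfolding u_sub_def
    by (auto simp: Der_def intro!: exI[of _ "\<lambda>j. 0"] polys_0)
next
  fix c :: 'a and v :: "'a mpoly \<Rightarrow> 'a mpoly" assume "c \<in> carrier class_ring" "v \<in> u_sub n i"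
  then obtain p where "v = (\<lambda>f. \<Sum>j=i..n. p j * \<partial> n j f)" "\<forall>j\<in>{i..n}. p j \<in> polys (j - 1)"
    unfolding u_sub_def by blast
  then show "c \<odot>\<^bsub>Der n\<^esub> v \<in> u_sub n i" unfolding u_sub_def
    by (auto simp: Der_def intro!: exI[of _ "\<lambda>j. Const c * p j"] polys_mult polys_Const simp: sum_distrib_left mult.assoc)
qed

lemma lbrack_u:
  fixes v w :: "'a::field mpoly \<Rightarrow> 'a mpoly"
  assumes "v \<in> u_sub n 1" "w \<in> u_sub n 1"
  shows "lbrack (Der n) v w \<in> u_sub n 1"
proof -
  obtain p q where v: "v = (\<lambda>f. \<Sum>j=1..n. p j * \<partial> n j f)" and p: "\<forall>j\<in>{1..n}. p j \<in> polys (j - 1)"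
     and w: "w = (\<lambda>f. \<Sum>j=1..n. q j * \<partial> n j f)" and q: "\<forall>j\<in>{1..n}. q j \<in> polys (j - 1)"
    using assms unfolding u_sub_def by blast
  define r where "r j = (\<Sum>i=1..n. p i * pdiff i (q j) - q i * pdiff i (p j))" for j
  have pq: "p j \<in> polys n \<and> q j \<in> polys n" if "j \<in> {1..n}" for j
    using p q polys_mono[of "j - 1" n] that by (meson atLeastAtMost_iff diff_le_self order_trans subsetD)
  have "r j \<in> polys (j - 1)" if j: "j \<in> {1..n}" for j
    unfolding r_def
  proof (intro polys_sum polys_diff)
    fix i assume i: "i \<in> {1..n}"
    have *: "a * pdiff i b \<in> polys (j - 1)" if "a \<in> polys (i - 1)" "b \<in> polys (j - 1)" for a b :: "'a mpoly"
    proof (cases "j - 1 < i")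
      case True then show ?thesis using that by (simp add: pdiff_eq_0 polys_0)
    next
      case False
      then have "a \<in> polys (j - 1)" using polys_mono[of "i - 1" "j - 1"] that by (meson diff_le_self not_less order_trans subsetD)
      then show ?thesis using that by (intro polys_mult pdiff_polys)
    qed
    show "p i * pdiff i (q j) \<in> polys (j - 1)" "q i * pdiff i (p j) \<in> polys (j - 1)"
      using i j p q by (blast intro: *)+
  qed
  moreover have "v (w f) - w (v f) = (\<Sum>j=1..n. r j * \<partial> n j f)" for f
  proof (cases "f \<in> polys n")
    case False
    then show ?thesis by (simp add: v w partial_def)
  next
    case f: True
    have vw: "(\<Sum>j=1..n. p j * pdiff j f) \<in> polys n" "(\<Sum>j=1..n. q j * pdiff j f) \<in> polys n"
      using pq f by (auto intro!: polys_sum polys_mult pdiff_polys)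
    have c: "(\<Sum>i=1..n. \<Sum>j=1..n. p i * (q j * pdiff i (pdiff j f))) = (\<Sum>i=1..n. \<Sum>j=1..n. q i * (p j * pdiff i (pdiff j f)))"
      by (subst sum.swap, intro sum.cong refl) (metis pdiff_commute mult.left_commute)
    have d: "(\<Sum>j=1..n. r j * pdiff j f) = (\<Sum>i=1..n. \<Sum>j=1..n. p i * (pdiff i (q j) * pdiff j f)) - (\<Sum>i=1..n. \<Sum>j=1..n. q i * (pdiff i (p j) * pdiff j f))"
    proof -
      have "(\<Sum>j=1..n. r j * pdiff j f) = (\<Sum>j=1..n. \<Sum>i=1..n. p i * (pdiff i (q j) * pdiff j f) - q i * (pdiff i (p j) * pdiff j f))"
        by (simp add: r_def sum_distrib_right left_diff_distrib mult.assoc)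
      also have "\<dots> = (\<Sum>i=1..n. \<Sum>j=1..n. p i * (pdiff i (q j) * pdiff j f) - q i * (pdiff i (p j) * pdiff j f))"
        by (rule sum.swap)
      finally show ?thesis by (simp add: sum_subtractf)
    qed
    have e: "v (w f) = (\<Sum>i=1..n. \<Sum>j=1..n. p i * (pdiff i (q j) * pdiff j f)) + (\<Sum>i=1..n. \<Sum>j=1..n. p i * (q j * pdiff i (pdiff j f)))"
      using f vw by (simp add: v w partial_def pdiff_sum pdiff_mult sum_distrib_left distrib_left sum.distrib)
    have e': "w (v f) = (\<Sum>i=1..n. \<Sum>j=1..n. q i * (pdiff i (p j) * pdiff j f)) + (\<Sum>i=1..n. \<Sum>j=1..n. q i * (p j * pdiff i (pdiff j f)))"
      using f vw by (simp add: v w partial_def pdiff_sum pdiff_mult sum_distrib_left distrib_left sum.distrib)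
    have g: "(\<Sum>j=1..n. r j * \<partial> n j f) = (\<Sum>j=1..n. r j * pdiff j f)"
      using f by (simp add: partial_def)
    show ?thesis unfolding e e' g d c by simp
  qed
  ultimately show ?thesis unfolding u_sub_def by (auto simp: Der_def)
qed

definition u_alg :: "nat \<Rightarrow> ('a::comm_ring_1, 'a mpoly \<Rightarrow> 'a mpoly) lie_alg" where
  "u_alg n = (Der n)\<lparr>carrier := u_sub n 1\<rparr>"

lemma lie_algebra_u: "lie_algebra class_ring (u_alg n :: ('a::field, _) lie_alg)"
proof -
  interpret D: lie_algebra class_ring "Der n :: ('a::field, _) lie_alg" by (rule lie_algebra_Der)
  have sub: "x \<in> carrier (Der n)" if "x \<in> u_sub n 1" for x :: "'a mpoly \<Rightarrow> 'a mpoly"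
    using that u_sub_subset by (auto simp: Der_def)
  show ?thesis
    unfolding u_alg_def
    by (intro lie_algebra.intro vectorspace.intro class_field lie_algebra_axioms.intro
       D.submodule_is_module submodule_u)
     (auto intro: sub[simplified] D.lbrack_add_left D.lbrack_add_right D.lbrack_smult_left D.lbrack_smult_right
        D.lbrack_self D.jacobi lbrack_u[simplified])
qed

definition K_partial :: "nat \<Rightarrow> ('a::comm_ring_1 mpoly \<Rightarrow> 'a mpoly) set" where
  "K_partial n = {\<lambda>f. Const c * \<partial> n n f | c. True}"

definition I_ideal :: "nat \<Rightarrow> nat \<Rightarrow> ('a::comm_ring_1 mpoly \<Rightarrow> 'a mpoly) set" where
  "I_ideal n s = {\<lambda>f. \<Sum>i<s. Const (c i) * Var 1 ^ i * \<partial> n n f | c. True}"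

end

theory Submission
  imports Defs
begin

text \<open>
  A derivation of \<open>P\<^sub>n\<close> is determined by its values on the variables, and \<open>D\<close> lies in
  \<open>u\<^sub>n\<close> exactly if \<open>D x\<^sub>j \<in> P\<^bsub>j-1\<^esub>\<close> for all \<open>j\<close> (lemma \<open>u_sub_iff\<close>). This triangular shape makes
  \<open>D\<close> locally nilpotent on \<open>P\<^sub>n\<close> (\<open>u_locally_nilpotent\<close>) and \<open>ad D\<close> locally nilpotent on
  \<open>u\<^sub>n\<close> (\<open>adjoint_locally_nilpotent\<close>). If moreover \<open>D x\<^sub>1 = 1\<close>, then \<open>ad D\<close> maps \<open>u\<^bsub>n,2\<^esub>\<close>
  onto itself (\<open>adjoint_surjective\<close>): \<open>u\<^bsub>n,2\<^esub>\<close> is a module over \<open>K[x\<^sub>1]\<close>, on which \<open>ad D\<close> obeys the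
  product rule, so \<open>[D, G] = E\<close> is solved by integrating by parts, and the process stops because
  \<open>ad D\<close> is locally nilpotent on \<open>E\<close>.

  Surjectivity gives the first two claims. An ideal not inside \<open>u\<^bsub>n,2\<^esub>\<close> contains some \<open>D\<close> with
  \<open>D x\<^sub>1 = 1\<close>, hence \<open>[D, u\<^bsub>n,2\<^esub>] = u\<^bsub>n,2\<^esub>\<close>, hence everything. If \<open>I\<close> is a co-finite ideal and
  \<open>T = ad \<partial>\<^sub>1\<close>, the chain of subspaces \<open>T\<^sup>-\<^sup>d(I)\<close> becomes stationary; as \<open>T\<close> is onto on
  \<open>u\<^bsub>n,2\<^esub>\<close>, this means that \<open>T\<close> is injective on \<open>u\<^bsub>n,2\<^esub>\<close> modulo \<open>I\<close>, and being locally nilpotent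
  there as well it forces \<open>u\<^bsub>n,2\<^esub> \<subseteq> I\<close>.

  The other two claims rest on \<open>[D, q\<partial>\<^sub>n] = D(q)\<partial>\<^sub>n\<close> for \<open>q \<in> P\<^bsub>n-1\<^esub>\<close>
  (\<open>commutator_vfield_last\<close>). Bracketing a nonzero element with \<open>x\<^sub>j\<partial>\<^sub>n\<close> leads to a nonzero
  \<open>q\<partial>\<^sub>n\<close> in the ideal, and bracketing with \<open>\<partial>\<^sub>1, \<dots>, \<partial>\<^bsub>n-1\<^esub>\<close> differentiates \<open>q\<close> down to a nonzero
  constant, since the characteristic is \<open>0\<close>; so \<open>K\<partial>\<^sub>n\<close> lies in every nonzero ideal. In an ideal
  of finite dimension no family \<open>x\<^sub>i\<^sup>kf\<partial>\<^sub>n\<close>, \<open>k \<ge> 0\<close>, with \<open>f \<noteq> 0\<close> can occur, because the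
  degrees in \<open>x\<^sub>i\<close> would be unbounded (\<open>finite_dim_no_powers\<close>). Bracketing with \<open>x\<^sub>j\<^sup>k\<partial>\<^sub>n\<close> and
  \<open>x\<^sub>1\<^sup>k\<partial>\<^sub>i\<close> produces such families, unless the ideal is inside \<open>K[x\<^sub>1]\<partial>\<^sub>n\<close>. There an element
  of degree \<open>d\<close> generates \<open>I\<^bsub>d+1\<^esub>\<close> by differentiation, so the ideal is \<open>I\<^sub>s\<close> for the last
  \<open>s\<close> with \<open>I\<^sub>s\<close> inside it.

  Dimensions are measured by chains: a strict chain of \<open>d + 1\<close> subspaces needs dimension at least
  \<open>d\<close>. This gives the lower bounds for \<open>dim I\<^sub>s\<close> and \<open>dim u\<^sub>n/u\<^bsub>n,2\<^esub>\<close>, and it gives the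
  ascending chain conditions used above.
\<close>

section \<open>Chains of subspaces\<close>

text \<open>Choosing in each step of the chain a vector that is new there gives independent vectors.\<close>

lemma (in vectorspace) strict_chain_le_dim:
  assumes "fin_dim"
    and sub: "\<And>k. k \<le> d \<Longrightarrow> submodule K (N k) V"
    and strict: "\<And>k. k < d \<Longrightarrow> N k \<subset> N (Suc k)"
  shows "d \<le> dim"
proof -
  have "\<forall>k. \<exists>y. k < d \<longrightarrow> y \<in> N (Suc k) \<and> y \<notin> N k" using strict by blast
  then obtain y where y: "\<And>k. k < d \<Longrightarrow> y k \<in> N (Suc k)" "\<And>k. k < d \<Longrightarrow> y k \<notin> N k" by metis
  have "j \<le> d \<Longrightarrow> y ` {..<j} \<subseteq> N j \<and> lin_indpt (y ` {..<j}) \<and> card (y ` {..<j}) = j" for j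
  proof (induction j)
    case 0
    then show ?case by (simp add: lin_dep_def)
  next
    case (Suc j)
    then have IH: "y ` {..<j} \<subseteq> N j" "lin_indpt (y ` {..<j})" "card (y ` {..<j}) = j" and j: "j < d" by auto
    have Nj: "submodule K (N j) V" "submodule K (N (Suc j)) V" using sub j by auto
    have inV: "y ` {..<j} \<subseteq> carrier V" "y j \<in> carrier V"
      using IH(1) y(1)[OF j] Nj submodule.subset by blast+
    have "span (y ` {..<j}) \<subseteq> N j" by (rule span_is_subset[OF IH(1) Nj(1)])
    then have "y j \<notin> span (y ` {..<j})" "y j \<notin> y ` {..<j}" using y(2)[OF j] IH(1) by auto
    then have "lin_indpt (y ` {..<j} \<union> {y j})"
      using lin_dep_iff_in_span[OF inV(1) IH(2) inV(2)] by blast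
    then show ?case using IH y(1)[OF j] strict[OF j] \<open>y j \<notin> y ` {..<j}\<close>
      by (auto simp: lessThan_Suc)
  qed
  from this[of d] have "y ` {..<d} \<subseteq> carrier V" "lin_indpt (y ` {..<d})" "card (y ` {..<d}) = d"
    using submodule.subset[OF sub[of d]] by auto
  with li_le_dim(2)[OF \<open>fin_dim\<close> this(1,2)] show ?thesis by simp
qed

lemma submodule_restrict:
  assumes "submodule K W V" "submodule K N V" "N \<subseteq> W"
  shows "submodule K N (V\<lparr>carrier := W\<rparr>)"
proof -
  interpret V: Module.module K V using assms(1) by (simp add: submodule_def)
  interpret N: submodule K N V by (rule assms(2))
  show ?thesis using V.submodule_is_module[OF assms(1)] assms(3) by (auto simp: submodule_def)
qed

lemma strict_chain_in_submodule:
  assumes V: "vectorspace K V" and W: "submodule K W V" and "finite_dim_in K V W"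
    and sub: "\<And>k. k \<le> d \<Longrightarrow> submodule K (N k) V" and le: "\<And>k. k \<le> d \<Longrightarrow> N k \<subseteq> W"
    and strict: "\<And>k. k < d \<Longrightarrow> N k \<subset> N (Suc k)"
  shows "d \<le> vectorspace.dim K (V\<lparr>carrier := W\<rparr>)"
proof -
  interpret V: vectorspace K V by (rule V)
  interpret W: vectorspace K "V\<lparr>carrier := W\<rparr>"
    by (intro V.subspace_is_vs subspace.intro V W)
  show ?thesis
    using assms(3)[unfolded finite_dim_in_def] submodule_restrict[OF W sub le] strict
    by (rule W.strict_chain_le_dim)
qed

lemma (in vectorspace) submodule_abelian_subgroup:
  assumes W: "submodule K W V"
  shows "abelian_subgroup W V"
proof -
  interpret W: submodule K W V by (rule W)
  have neg: "\<ominus>\<^bsub>V\<^esub> x \<in> W" if "x \<in> W" for x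
    using that W.smult_closed[of "\<ominus>\<^bsub>K\<^esub> \<one>\<^bsub>K\<^esub>" x] W.subset
    by (metis R.add.inv_closed R.one_closed smult_l_minus smult_one subsetD)
  have "additive_subgroup W V"
    using W.subset neg
    by (intro additive_subgroup.intro add.subgroupI) (auto simp: a_inv_def[symmetric] intro: W.zero_closed)
  then show ?thesis
    by (rule abelian_subgroupI3) (rule M.abelian_group_axioms)
qed

lemma (in vectorspace) coset_eqD:
  assumes W: "submodule K W V" and N: "submodule K N V" and "W \<subseteq> N"
    and "W +>\<^bsub>V\<^esub> x = W +>\<^bsub>V\<^esub> y" "x \<in> carrier V" "y \<in> N"
  shows "x \<in> N"
proof -
  interpret S: abelian_subgroup W V by (rule submodule_abelian_subgroup[OF W])
  have "x \<in> W +>\<^bsub>V\<^esub> y" using S.a_rcos_self[OF assms(5)] assms(4) by simp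
  then obtain w where "w \<in> W" "x = w \<oplus>\<^bsub>V\<^esub> y" by (auto simp: a_r_coset_def')
  then show ?thesis using submodule.m_closed[OF N, of w y] \<open>W \<subseteq> N\<close> \<open>y \<in> N\<close> by blast
qed

text \<open>Computing with representatives replaces the setwise operations of the quotient space. A coset is
  determined by any of its elements, which settles the scalar multiplication.\<close>

lemma coset_operations:
  assumes V: "vectorspace K V" and W: "submodule K W V"
  shows "x \<in> carrier V \<Longrightarrow> W +>\<^bsub>V\<^esub> x \<in> carrier (quot_vs V W)"
    and "x \<in> carrier V \<Longrightarrow> y \<in> carrier V \<Longrightarrow>
      (W +>\<^bsub>V\<^esub> x) \<oplus>\<^bsub>quot_vs V W\<^esub> (W +>\<^bsub>V\<^esub> y) = W +>\<^bsub>V\<^esub> (x \<oplus>\<^bsub>V\<^esub> y)"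
    and "c \<in> carrier K \<Longrightarrow> x \<in> carrier V \<Longrightarrow>
      c \<odot>\<^bsub>quot_vs V W\<^esub> (W +>\<^bsub>V\<^esub> x) = W +>\<^bsub>V\<^esub> (c \<odot>\<^bsub>V\<^esub> x)"
    and "\<zero>\<^bsub>quot_vs V W\<^esub> = W +>\<^bsub>V\<^esub> \<zero>\<^bsub>V\<^esub>"
    and "X \<in> carrier (quot_vs V W) \<Longrightarrow> \<exists>x\<in>carrier V. X = W +>\<^bsub>V\<^esub> x"
proof -
  interpret V: vectorspace K V by (rule V)
  interpret W: submodule K W V by (rule W)
  interpret S: abelian_subgroup W V by (rule V.submodule_abelian_subgroup[OF W])
  interpret Q: vectorspace K "quot_vs V W" by (rule vectorspace_quot[OF V W])
  show coset: "W +>\<^bsub>V\<^esub> x \<in> carrier (quot_vs V W)" if "x \<in> carrier V" for x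
    using that by (auto simp: quot_vs_def A_RCOSETS_def')
  show "x \<in> carrier V \<Longrightarrow> y \<in> carrier V \<Longrightarrow>
      (W +>\<^bsub>V\<^esub> x) \<oplus>\<^bsub>quot_vs V W\<^esub> (W +>\<^bsub>V\<^esub> y) = W +>\<^bsub>V\<^esub> (x \<oplus>\<^bsub>V\<^esub> y)"
    by (simp add: quot_vs_def S.a_rcos_sum)
  show "\<zero>\<^bsub>quot_vs V W\<^esub> = W +>\<^bsub>V\<^esub> \<zero>\<^bsub>V\<^esub>"
    using W.subset by (force simp: quot_vs_def a_r_coset_def')
  show coset_ex: "\<exists>x\<in>carrier V. X = W +>\<^bsub>V\<^esub> x" if "X \<in> carrier (quot_vs V W)" for X
    using that by (auto simp: quot_vs_def A_RCOSETS_def')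
  show "c \<odot>\<^bsub>quot_vs V W\<^esub> (W +>\<^bsub>V\<^esub> x) = W +>\<^bsub>V\<^esub> (c \<odot>\<^bsub>V\<^esub> x)"
    if c: "c \<in> carrier K" and x: "x \<in> carrier V"
  proof -
    let ?X = "c \<odot>\<^bsub>quot_vs V W\<^esub> (W +>\<^bsub>V\<^esub> x)"
    \<comment> \<open>The product is some coset, and it contains \<open>cx\<close>.\<close>
    obtain z where z: "z \<in> carrier V" "?X = W +>\<^bsub>V\<^esub> z"
      using Q.smult_closed[OF c coset[OF x]] coset_ex by blast
    have "c \<odot>\<^bsub>V\<^esub> x \<in> (\<odot>\<^bsub>V\<^esub>) c ` (W +>\<^bsub>V\<^esub> x)" using S.a_rcos_self[OF x] by blast
    moreover have "?X = W <+>\<^bsub>V\<^esub> ((\<odot>\<^bsub>V\<^esub>) c ` (W +>\<^bsub>V\<^esub> x))" by (simp add: quot_vs_def)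
    ultimately have "\<zero>\<^bsub>V\<^esub> \<oplus>\<^bsub>V\<^esub> c \<odot>\<^bsub>V\<^esub> x \<in> ?X"
      using W.zero_closed by (simp only: set_add_def') blast
    then have "c \<odot>\<^bsub>V\<^esub> x \<in> W +>\<^bsub>V\<^esub> z" unfolding z(2) using c x by simp
    then show ?thesis unfolding z(2) using z(1) by (rule S.a_repr_independence')
  qed
qed

lemma submodule_quot:
  assumes V: "vectorspace K V" and W: "submodule K W V" and N: "submodule K N V"
  shows "submodule K ((\<lambda>x. W +>\<^bsub>V\<^esub> x) ` N) (quot_vs V W)"
proof -
  interpret V: vectorspace K V by (rule V)
  interpret N: submodule K N V by (rule N)
  interpret Q: vectorspace K "quot_vs V W" by (rule vectorspace_quot[OF V W])
  note co = coset_operations[OF V W]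
  have inV: "x \<in> N \<Longrightarrow> x \<in> carrier V" for x using N.subset by blast
  show ?thesis
  proof (rule submodule.intro)
    show "module K (quot_vs V W)" by (rule Q.module_axioms)
    show "\<zero>\<^bsub>quot_vs V W\<^esub> \<in> (\<lambda>x. W +>\<^bsub>V\<^esub> x) ` N" by (simp add: co(4))
    show "(\<lambda>x. W +>\<^bsub>V\<^esub> x) ` N \<subseteq> carrier (quot_vs V W)" using co(1) inV by blast
  next
    fix X Y assume "X \<in> (\<lambda>x. W +>\<^bsub>V\<^esub> x) ` N" "Y \<in> (\<lambda>x. W +>\<^bsub>V\<^esub> x) ` N"
    then obtain x y where xy: "x \<in> N" "X = W +>\<^bsub>V\<^esub> x" "y \<in> N" "Y = W +>\<^bsub>V\<^esub> y" by blast
    show "X \<oplus>\<^bsub>quot_vs V W\<^esub> Y \<in> (\<lambda>x. W +>\<^bsub>V\<^esub> x) ` N"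
      unfolding xy(2,4) co(2)[OF inV[OF xy(1)] inV[OF xy(3)]] by (intro imageI N.m_closed xy)
  next
    fix c X assume c: "c \<in> carrier K" and "X \<in> (\<lambda>x. W +>\<^bsub>V\<^esub> x) ` N"
    then obtain x where x: "x \<in> N" "X = W +>\<^bsub>V\<^esub> x" by blast
    show "c \<odot>\<^bsub>quot_vs V W\<^esub> X \<in> (\<lambda>x. W +>\<^bsub>V\<^esub> x) ` N"
      unfolding x(2) co(3)[OF c inV[OF x(1)]] by (intro imageI N.smult_closed c x)
  qed
qed

text \<open>A subspace that contains \<open>W\<close> is recovered from its image in \<open>V/W\<close>, so strict inclusions
  survive in the quotient.\<close>

lemma strict_chain_mod_submodule:
  assumes V: "vectorspace K V" and W: "submodule K W V" and fin: "cofinite_in K V W"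
    and sub: "\<And>k. k \<le> d \<Longrightarrow> submodule K (N k) V" and le: "\<And>k. k \<le> d \<Longrightarrow> W \<subseteq> N k"
    and strict: "\<And>k. k < d \<Longrightarrow> N k \<subset> N (Suc k)"
  shows "d \<le> vectorspace.dim K (quot_vs V W)"
proof -
  interpret V: vectorspace K V by (rule V)
  interpret Q: vectorspace K "quot_vs V W" by (rule vectorspace_quot[OF V W])
  have "(\<lambda>x. W +>\<^bsub>V\<^esub> x) ` N k \<subset> (\<lambda>x. W +>\<^bsub>V\<^esub> x) ` N (Suc k)" if k: "k < d" for k
  proof -
    obtain y where y: "y \<in> N (Suc k)" "y \<notin> N k" using strict[OF k] by blast
    have "y \<in> carrier V" using y(1) sub[of "Suc k"] k submodule.subset by fastforce
    then have "W +>\<^bsub>V\<^esub> y \<notin> (\<lambda>x. W +>\<^bsub>V\<^esub> x) ` N k"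
      using V.coset_eqD[OF W sub[of k] le[of k]] k y(2) by auto
    then show ?thesis using y(1) strict[OF k] by blast
  qed
  moreover have "submodule K ((\<lambda>x. W +>\<^bsub>V\<^esub> x) ` N k) (quot_vs V W)" if "k \<le> d" for k
    by (rule submodule_quot[OF V W sub[OF that]])
  ultimately show ?thesis
    using Q.strict_chain_le_dim[OF fin[unfolded cofinite_in_def], of d "\<lambda>k. (\<lambda>x. W +>\<^bsub>V\<^esub> x) ` N k"] by blast
qed

section \<open>Polynomials\<close>

text \<open>Rewriting \<open>1\<close> to \<open>Suc 0\<close> would destroy the form in which variables and indices occur in
  the lemmas on \<^const>\<open>polys\<close> and \<^const>\<open>pdiff\<close>.\<close>

declare One_nat_def [simp del]

text \<open>Read off coefficient by coefficient, the derivative involves no truncated subtraction of exponents.\<close>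

lemma lookup_pdiff:
  "Poly_Mapping.lookup (pdiff i f) m =
    of_nat (Suc (Poly_Mapping.lookup m i)) * Poly_Mapping.lookup f (m + Poly_Mapping.single i 1)"
proof -
  have *: "Poly_Mapping.lookup (Poly_Mapping.single (k - Poly_Mapping.single i 1)
        (of_nat (Poly_Mapping.lookup k i) * Poly_Mapping.lookup f k)) m =
      (if k = m + Poly_Mapping.single i 1
       then of_nat (Suc (Poly_Mapping.lookup m i)) * Poly_Mapping.lookup f k else 0)" for k
  proof (cases "Poly_Mapping.lookup k i = 0")
    case True
    then have "k \<noteq> m + Poly_Mapping.single i 1" by (auto simp: lookup_add)
    then show ?thesis using True by simp
  next
    case False
    then have "k = (k - Poly_Mapping.single i 1) + Poly_Mapping.single i 1"
      by (intro poly_mapping_eqI) (auto simp: lookup_add lookup_minus lookup_single when_def)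
    then have "k - Poly_Mapping.single i 1 = m \<longleftrightarrow> k = m + Poly_Mapping.single i 1"
      by (metis add_diff_cancel_right')
    then show ?thesis by (auto simp: lookup_single when_def lookup_add algebra_simps)
  qed
  show ?thesis
    unfolding pdiff_def lookup_sum * by (simp add: sum.delta in_keys_iff)
qed

lemma monomial_split:
  "i \<in> Poly_Mapping.keys m \<Longrightarrow> m = (m - Poly_Mapping.single i 1) + Poly_Mapping.single i (1::nat)"
  by (intro poly_mapping_eqI) (auto simp: lookup_add lookup_minus lookup_single when_def in_keys_iff)

lemma pdiff_nonzero:
  fixes f :: "'a::field_char_0 mpoly"
  assumes "m \<in> Poly_Mapping.keys f" "i \<in> Poly_Mapping.keys m"
  shows "pdiff i f \<noteq> 0"
proof
  assume "pdiff i f = 0"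
  then have "Poly_Mapping.lookup (pdiff i f) (m - Poly_Mapping.single i 1) = 0" by simp
  then have "Poly_Mapping.lookup f m = 0"
    unfolding lookup_pdiff monomial_split[OF assms(2), symmetric] by (simp del: of_nat_Suc)
  then show False using assms(1) by (simp add: in_keys_iff)
qed

lemma polys_Var: "1 \<le> j \<Longrightarrow> j \<le> i \<Longrightarrow> Var j \<in> polys i"
  by (simp add: polys_def)

lemma polys_1: "(1 :: 'a::comm_ring_1 mpoly) \<in> polys i"
  using polys_Const[of "1 :: 'a" i] by simp

lemma polys_power: "f \<in> polys i \<Longrightarrow> f ^ k \<in> polys i" for f :: "'a::comm_ring_1 mpoly"
  by (induction k) (auto simp: polys_1 polys_mult)

lemma polys_0_Const: "f \<in> polys 0 \<Longrightarrow> \<exists>c. f = Const c"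
proof -
  assume "f \<in> polys 0"
  then have *: "Poly_Mapping.keys f \<subseteq> {0}" by (auto simp: polys_def)
  have "f = Const (Poly_Mapping.lookup f 0)"
    using * by (intro poly_mapping_eqI) (auto simp: lookup_single when_def in_keys_iff)
  then show ?thesis by blast
qed

text \<open>\<open>P\<^sub>n\<close> is generated as a ring by the constants and the variables; monomials are built up by
  induction on the total degree.\<close>

lemma polys_induct [consumes 1, case_names Const Var add mult]:
  fixes f :: "'a::comm_ring_1 mpoly"
  assumes f: "f \<in> polys n"
    and Const: "\<And>c. P (Const c)"
    and Var: "\<And>j. 1 \<le> j \<Longrightarrow> j \<le> n \<Longrightarrow> P (Var j)"
    and add: "\<And>f g. f \<in> polys n \<Longrightarrow> g \<in> polys n \<Longrightarrow> P f \<Longrightarrow> P g \<Longrightarrow> P (f + g)"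
    and mult: "\<And>f g. f \<in> polys n \<Longrightarrow> g \<in> polys n \<Longrightarrow> P f \<Longrightarrow> P g \<Longrightarrow> P (f * g)"
  shows "P f"
proof -
  have mono: "P (Poly_Mapping.single m c)" if "Poly_Mapping.keys m \<subseteq> {1..n}" for m and c :: 'a
    using that
  proof (induction "\<Sum>j\<in>{1..n}. Poly_Mapping.lookup m j" arbitrary: m rule: less_induct)
    case less
    show ?case
    proof (cases "m = 0")
      case True
      then show ?thesis by (simp add: Const)
    next
      case False
      then obtain i where i: "i \<in> Poly_Mapping.keys m" by (metis keys_eq_empty ex_in_conv)
      then have i': "i \<in> {1..n}" using less.prems by blast
      let ?m = "m - Poly_Mapping.single i (1::nat)"
      have sub: "Poly_Mapping.keys ?m \<subseteq> {1..n}"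
        using less.prems by (auto simp: in_keys_iff lookup_minus)
      have "(\<Sum>j\<in>{1..n}. Poly_Mapping.lookup ?m j) < (\<Sum>j\<in>{1..n}. Poly_Mapping.lookup m j)"
        using i i' by (intro sum_strict_mono_ex1) (auto simp: lookup_minus in_keys_iff intro!: bexI[of _ i])
      then have "P (Poly_Mapping.single ?m c)" using less.hyps sub by blast
      then have "P (Poly_Mapping.single ?m c * Var i)"
        using sub i' by (intro mult Var polys_Var) (auto simp: polys_def)
      then show ?thesis
        by (simp only: mult_single monomial_split[OF i, symmetric] mult_1_right)
    qed
  qed
  have "P (\<Sum>m\<in>A. Poly_Mapping.single m (Poly_Mapping.lookup f m))"
    if "finite A" "A \<subseteq> Poly_Mapping.keys f" for A
    using that
  proof (induction A rule: finite_induct)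
    case empty
    then show ?case using Const[of 0] by simp
  next
    case (insert m A)
    have *: "Poly_Mapping.single k (Poly_Mapping.lookup f k) \<in> polys n" if "k \<in> Poly_Mapping.keys f" for k
      using that f by (auto simp: polys_def)
    have "(\<Sum>m\<in>A. Poly_Mapping.single m (Poly_Mapping.lookup f m)) \<in> polys n"
      using insert.prems * by (intro polys_sum) blast
    moreover have "P (Poly_Mapping.single m (Poly_Mapping.lookup f m))"
      using insert.prems f by (intro mono) (auto simp: polys_def)
    ultimately show ?case using insert * by (simp add: add)
  qed
  from this[of "Poly_Mapping.keys f"] show ?thesis by (simp add: poly_sum_singles)
qed

lemma pdiff_Var: "pdiff i (Var j) = (if i = j then 1 else 0)"
  by (simp add: pdiff_single lookup_single when_def)

section \<open>Derivations\<close>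

lemma derivations_simps:
  assumes "D \<in> derivations n"
  shows "f \<in> polys n \<Longrightarrow> D f \<in> polys n" "f \<notin> polys n \<Longrightarrow> D f = 0"
    "f \<in> polys n \<Longrightarrow> g \<in> polys n \<Longrightarrow> D (f + g) = D f + D g"
    "f \<in> polys n \<Longrightarrow> D (Const c * f) = Const c * D f"
    "f \<in> polys n \<Longrightarrow> g \<in> polys n \<Longrightarrow> D (f * g) = D f * g + f * D g"
  using assms unfolding derivations_def by auto

lemma derivation_Const:
  assumes "D \<in> derivations n"
  shows "D (Const c) = 0"
proof -
  have "D 1 = D 1 + D 1"
    using derivations_simps(5)[OF assms polys_1 polys_1] by simp
  then have "D 1 = 0" by simp
  then show ?thesis using derivations_simps(4)[OF assms polys_1, of c] by simp
qed

lemma derivation_0: "D \<in> derivations n \<Longrightarrow> D 0 = 0"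
  using derivation_Const[of D n 0] by simp

lemma derivation_power:
  assumes "D \<in> derivations n" "f \<in> polys n"
  shows "D (f ^ Suc k) = of_nat (Suc k) * f ^ k * D f"
proof (induction k)
  case (Suc k)
  have "D (f ^ Suc (Suc k)) = D f * f ^ Suc k + f * D (f ^ Suc k)"
    using derivations_simps(5)[OF assms polys_power[OF assms(2), of "Suc k"]] by simp
  also have "\<dots> = of_nat (Suc (Suc k)) * f ^ Suc k * D f"
    unfolding Suc by (simp add: algebra_simps)
  finally show ?case .
qed simp

lemma derivation_eqI:
  assumes D: "D \<in> derivations n" and E: "E \<in> derivations n"
    and eq: "\<And>j. 1 \<le> j \<Longrightarrow> j \<le> n \<Longrightarrow> D (Var j) = E (Var j)"
  shows "D = E"
proof
  fix f
  show "D f = E f"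
  proof (cases "f \<in> polys n")
    case True
    then show ?thesis
      by (induction rule: polys_induct)
        (simp_all add: derivation_Const[OF D] derivation_Const[OF E] eq
           derivations_simps(3,5)[OF D] derivations_simps(3,5)[OF E])
  qed (simp add: derivations_simps(2)[OF D] derivations_simps(2)[OF E])
qed

text \<open>A description of \<open>u\<^bsub>n,i\<^esub>\<close> by values on the variables. All later arguments use it in place of the
  coefficients: \<open>D = D(x\<^sub>1)\<partial>\<^sub>1 + \<cdots> + D(x\<^sub>n)\<partial>\<^sub>n\<close>.\<close>

lemma u_sub_iff:
  assumes "1 \<le> i"
  shows "D \<in> u_sub n i \<longleftrightarrow> D \<in> derivations n \<and>
    (\<forall>j\<in>{1..n}. D (Var j) \<in> polys (j - 1) \<and> (j < i \<longrightarrow> D (Var j) = 0))"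
proof -
  have val: "(\<Sum>j=i..n. p j * \<partial> n j (Var k)) = (if i \<le> k then p k else 0)"
    if "k \<in> {1..n}" for p and k :: nat
  proof -
    have "(\<Sum>j=i..n. p j * \<partial> n j (Var k)) = (\<Sum>j=i..n. if j = k then p j else 0)"
      using that by (intro sum.cong refl) (simp add: partial_def polys_Var pdiff_Var)
    then show ?thesis using that by (simp add: sum.delta)
  qed
  show ?thesis
  proof
    assume D: "D \<in> u_sub n i"
    then obtain p where p: "D = (\<lambda>f. \<Sum>j=i..n. p j * \<partial> n j f)" "\<forall>j\<in>{i..n}. p j \<in> polys (j - 1)"
      unfolding u_sub_def by blast
    show "D \<in> derivations n \<and>
        (\<forall>j\<in>{1..n}. D (Var j) \<in> polys (j - 1) \<and> (j < i \<longrightarrow> D (Var j) = 0))"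
      using D u_sub_subset p(2) by (auto simp only: p(1) val polys_0 atLeastAtMost_iff not_less split: if_splits)
  next
    assume *: "D \<in> derivations n \<and>
        (\<forall>j\<in>{1..n}. D (Var j) \<in> polys (j - 1) \<and> (j < i \<longrightarrow> D (Var j) = 0))"
    define E where "E = (\<lambda>f. \<Sum>j=i..n. D (Var j) * \<partial> n j f)"
    have E: "E \<in> u_sub n i"
      unfolding u_sub_def E_def using * assms by auto
    have "D = E"
    proof (rule derivation_eqI)
      show "E \<in> derivations n" using E u_sub_subset by blast
      show "D (Var j) = E (Var j)" if "1 \<le> j" "j \<le> n" for j
        using that * val[of j "\<lambda>j. D (Var j)"] by (simp add: E_def)
    qed (use * in blast)
    then show "D \<in> u_sub n i" using E by simp
  qed
qed

lemma u_sub_derivation: "D \<in> u_sub n i \<Longrightarrow> D \<in> derivations n"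
  using u_sub_subset by blast

lemma u_sub_mono: "1 \<le> i \<Longrightarrow> i \<le> j \<Longrightarrow> u_sub n j \<subseteq> u_sub n i"
  by (auto simp: u_sub_iff)

lemma u_sub_polys:
  assumes "D \<in> u_sub n 1" "i \<le> n" "f \<in> polys i"
  shows "D f \<in> polys i"
proof -
  have D: "D \<in> derivations n" by (rule u_sub_derivation[OF assms(1)])
  have sub: "g \<in> polys n" if "g \<in> polys i" for g :: "'a mpoly" using that polys_mono[OF assms(2)] by blast
  show ?thesis using assms(3)
  proof (induction rule: polys_induct)
    case (Var j)
    then have "D (Var j) \<in> polys (j - 1)" using assms(1,2) by (auto simp: u_sub_iff)
    then show ?case using polys_mono[of "j - 1" i] Var by fastforce
  qed (auto simp: derivation_Const[OF D] polys_0 derivations_simps[OF D] sub intro: polys_add polys_mult)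
qed

lemma u_sub_vanish:
  assumes "D \<in> u_sub n i" "k < i" "k \<le> n" "f \<in> polys k"
  shows "D f = 0"
proof -
  have D: "D \<in> derivations n" by (rule u_sub_derivation[OF assms(1)])
  have sub: "g \<in> polys n" if "g \<in> polys k" for g :: "'a mpoly" using that polys_mono[OF assms(3)] by blast
  show ?thesis using assms(4)
  proof (induction rule: polys_induct)
    case (Var j)
    then show ?case using assms(1-3) u_sub_iff[of i D n] by auto
  qed (auto simp: derivation_Const[OF D] derivations_simps[OF D] sub)
qed

definition commutator :: "('a::comm_ring_1 mpoly \<Rightarrow> 'a mpoly) \<Rightarrow> ('a mpoly \<Rightarrow> 'a mpoly) \<Rightarrow> 'a mpoly \<Rightarrow> 'a mpoly" where
  "commutator D E = (\<lambda>f. D (E f) - E (D f))"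

lemma Der_simps:
  "carrier (Der n) = derivations n" "\<zero>\<^bsub>Der n\<^esub> = (\<lambda>f. 0)"
  "D \<oplus>\<^bsub>Der n\<^esub> E = (\<lambda>f. D f + E f)" "c \<odot>\<^bsub>Der n\<^esub> D = (\<lambda>f. Const c * D f)"
  "lbrack (Der n) D E = commutator D E"
  by (simp_all add: Der_def commutator_def)

lemma u_alg_simps:
  "carrier (u_alg n) = u_sub n 1" "\<zero>\<^bsub>u_alg n\<^esub> = (\<lambda>f. 0)"
  "D \<oplus>\<^bsub>u_alg n\<^esub> E = (\<lambda>f. D f + E f)" "c \<odot>\<^bsub>u_alg n\<^esub> D = (\<lambda>f. Const c * D f)"
  "lbrack (u_alg n) D E = commutator D E"
  by (simp_all add: u_alg_def Der_simps)

lemma vectorspace_u: "vectorspace class_ring (u_alg n :: ('a::field, _) lie_alg)"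
  by (rule lie_algebra.axioms(1)[OF lie_algebra_u])

lemma submodule_u_alg_iff:
  "submodule class_ring I (u_alg n :: ('a::field, _) lie_alg) \<longleftrightarrow>
     I \<subseteq> u_sub n 1 \<and> (\<lambda>f. 0) \<in> I \<and> (\<forall>D\<in>I. \<forall>E\<in>I. (\<lambda>f. D f + E f) \<in> I) \<and>
     (\<forall>c. \<forall>D\<in>I. (\<lambda>f. Const c * D f) \<in> I)"
  using vectorspace_u[of n, where ?'a='a]
  by (auto simp: submodule_def u_alg_simps vectorspace_def)

lemma submodule_u_sub:
  "1 \<le> i \<Longrightarrow> submodule class_ring (u_sub n i) (u_alg n :: ('a::field, _) lie_alg)"
  using submodule_u[of n i, where ?'a='a] u_sub_mono[of 1 i n, where ?'a='a]
  unfolding submodule_u_alg_iff unfolding submodule_def Der_simps by simp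

lemma u_sub_commutator:
  assumes "1 \<le> i" "D \<in> u_sub n 1" "E \<in> u_sub n i"
  shows "commutator D (E :: 'a::field mpoly \<Rightarrow> 'a mpoly) \<in> u_sub n i"
proof -
  have E1: "E \<in> u_sub n 1" using u_sub_mono[of 1 i n] assms by auto
  have D: "D \<in> derivations n" by (rule u_sub_derivation[OF assms(2)])
  have "commutator D E \<in> u_sub n 1"
    using lbrack_u[OF assms(2) E1] by (simp only: Der_simps)
  moreover have "commutator D E (Var j) = 0" if "1 \<le> j" "j \<le> n" "j < i" for j
  proof -
    have "D (Var j) \<in> polys (j - 1)" using assms(2) that by (auto simp: u_sub_iff)
    then have "E (D (Var j)) = 0" using u_sub_vanish[OF assms(3), of "j - 1"] that by simp
    moreover have "E (Var j) = 0" using assms(1,3) that by (auto simp: u_sub_iff)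
    ultimately show ?thesis by (simp add: commutator_def derivation_0[OF D])
  qed
  ultimately show ?thesis using assms(1) by (auto simp: u_sub_iff)
qed

section \<open>Nilpotency and surjectivity of the adjoint action\<close>

lemma derivation_range: "D \<in> derivations n \<Longrightarrow> D f \<in> polys n"
  by (cases "f \<in> polys n") (auto simp: derivations_simps polys_0)

lemma funpow_derivation:
  assumes D: "D \<in> derivations n"
  shows "f \<in> polys n \<Longrightarrow> (D ^^ k) f \<in> polys n" and "(D ^^ k) 0 = 0"
    and "f \<in> polys n \<Longrightarrow> g \<in> polys n \<Longrightarrow> (D ^^ k) (f + g) = (D ^^ k) f + (D ^^ k) g"
proof -
  show 1: "(D ^^ k) f \<in> polys n" if "f \<in> polys n" for f k
    using that by (induction k) (auto simp: derivation_range[OF D])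
  show "(D ^^ k) 0 = 0" by (induction k) (auto simp: derivation_0[OF D])
  show "(D ^^ k) (f + g) = (D ^^ k) f + (D ^^ k) g" if "f \<in> polys n" "g \<in> polys n"
    using that by (induction k) (auto simp: derivations_simps[OF D] 1)
qed

lemma funpow_derivation_vanish:
  "D \<in> derivations n \<Longrightarrow> (D ^^ k) f = 0 \<Longrightarrow> (D ^^ (k + l)) f = 0"
  by (simp add: add.commute[of k] funpow_add funpow_derivation(2))

text \<open>By the product rule, each application of \<open>D\<close> uses up one of the \<open>k + l\<close> steps in one of the factors.\<close>

lemma funpow_derivation_mult:
  assumes D: "D \<in> derivations n" and "f \<in> polys n" "g \<in> polys n" "(D ^^ k) f = 0" "(D ^^ l) g = 0"
  shows "(D ^^ (k + l)) (f * g) = 0"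
  using assms(2-)
proof (induction "k + l" arbitrary: k l f g)
  case 0
  then show ?case by simp
next
  case (Suc m)
  show ?case
  proof (cases "k = 0 \<or> l = 0")
    case True
    then have "f * g = 0" using Suc.prems by auto
    then show ?thesis by (simp add: funpow_derivation(2)[OF D])
  next
    case False
    then obtain k' l' where kl: "k = Suc k'" "l = Suc l'" by (metis not0_implies_Suc)
    have "(D ^^ m) (D f * g) = 0"
      using Suc.hyps(1)[of k' l "D f" g] Suc.hyps(2) Suc.prems
      by (simp add: kl funpow_Suc_right derivation_range[OF D] del: funpow.simps)
    moreover have "(D ^^ m) (f * D g) = 0"
      using Suc.hyps(1)[of k l' f "D g"] Suc.hyps(2) Suc.prems
      by (simp add: kl funpow_Suc_right derivation_range[OF D] del: funpow.simps)
    ultimately have "(D ^^ m) (D (f * g)) = 0"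
      using Suc.prems
      by (simp add: derivations_simps(5)[OF D] funpow_derivation(3)[OF D] polys_mult derivation_range[OF D])
    then show ?thesis
      unfolding Suc.hyps(2)[symmetric] by (simp add: funpow_Suc_right del: funpow.simps)
  qed
qed

text \<open>The polynomials killed by a power of \<open>D\<close> form a ring, which contains \<open>x\<^sub>j\<close> as soon as it
  contains \<open>P\<^bsub>j-1\<^esub>\<close>, because \<open>D x\<^sub>j \<in> P\<^bsub>j-1\<^esub>\<close>.\<close>

lemma u_locally_nilpotent:
  assumes D: "D \<in> u_sub n 1" and "i \<le> n" "f \<in> polys i"
  shows "\<exists>k. (D ^^ k) f = 0"
  using assms(2,3)
proof (induction i arbitrary: f)
  case 0
  then obtain c where "f = Const c" using polys_0_Const by blast
  then have "(D ^^ Suc 0) f = 0" using derivation_Const[OF u_sub_derivation[OF D]] by simp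
  then show ?case by blast
next
  case (Suc i)
  note D' = u_sub_derivation[OF D]
  have sub: "g \<in> polys n" if "g \<in> polys (Suc i)" for g :: "'a mpoly"
    using that polys_mono[OF Suc.prems(1)] by blast
  show ?case using Suc.prems(2)
  proof (induction rule: polys_induct)
    case (Const c)
    have "(D ^^ Suc 0) (Const c) = 0" using derivation_Const[OF D'] by simp
    then show ?case by blast
  next
    case (Var j)
    then have "D (Var j) \<in> polys (j - 1)" using D Suc.prems(1) by (auto simp: u_sub_iff)
    moreover have "polys (j - 1) \<subseteq> polys i" using Var by (intro polys_mono) auto
    ultimately obtain k where "(D ^^ k) (D (Var j)) = 0" using Suc.IH Suc.prems(1) by fastforce
    then have "(D ^^ Suc k) (Var j) = 0" by (simp add: funpow_Suc_right del: funpow.simps)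
    then show ?case by blast
  next
    case (add f g)
    then obtain k l where "(D ^^ k) f = 0" "(D ^^ l) g = 0" by blast
    then have "(D ^^ (k + l)) f = 0" "(D ^^ (l + k)) g = 0"
      using funpow_derivation_vanish[OF D'] by blast+
    then have "(D ^^ (k + l)) (f + g) = 0"
      using add.hyps sub by (simp add: funpow_derivation(3)[OF D'] add.commute)
    then show ?case by blast
  next
    case (mult f g)
    then show ?case using funpow_derivation_mult[OF D'] sub by blast
  qed
qed

lemma commutator_linear:
  assumes D: "D \<in> derivations n" and "E \<in> derivations n" "F \<in> derivations n"
  shows "commutator D (\<lambda>f. E f + F f) = (\<lambda>f. commutator D E f + commutator D F f)"
    and "commutator D (\<lambda>f. Const c * E f) = (\<lambda>f. Const c * commutator D E f)"
    and "commutator D (\<lambda>f. E f - F f) = (\<lambda>f. commutator D E f - commutator D F f)"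
proof -
  note r = derivation_range[OF assms(2)] derivation_range[OF assms(3)]
  show "commutator D (\<lambda>f. E f + F f) = (\<lambda>f. commutator D E f + commutator D F f)"
    by (simp add: commutator_def derivations_simps[OF D] r algebra_simps)
  show "commutator D (\<lambda>f. Const c * E f) = (\<lambda>f. Const c * commutator D E f)"
    by (simp add: commutator_def derivations_simps[OF D] r right_diff_distrib)
  have diff: "D (g - h) = D g - D h" if "g \<in> polys n" "h \<in> polys n" for g h
    using derivations_simps(3)[OF D polys_diff[OF that] that(2)] by simp
  show "commutator D (\<lambda>f. E f - F f) = (\<lambda>f. commutator D E f - commutator D F f)"
    unfolding commutator_def diff[OF r] by (simp add: algebra_simps)
qed

lemma commutator_0: "D \<in> derivations n \<Longrightarrow> commutator D (\<lambda>f. 0) = (\<lambda>f. 0)"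
  by (simp add: commutator_def derivation_0)

lemma funpow_commutator:
  fixes D :: "'a::field mpoly \<Rightarrow> 'a mpoly"
  assumes D: "D \<in> u_sub n 1"
  shows "1 \<le> i \<Longrightarrow> E \<in> u_sub n i \<Longrightarrow> (commutator D ^^ k) E \<in> u_sub n i"
    and "(commutator D ^^ k) (\<lambda>f. 0) = (\<lambda>f. 0)"
    and "E \<in> u_sub n 1 \<Longrightarrow> F \<in> u_sub n 1 \<Longrightarrow> (commutator D ^^ k) (\<lambda>f. E f + F f) =
      (\<lambda>f. (commutator D ^^ k) E f + (commutator D ^^ k) F f)"
    and "E \<in> u_sub n 1 \<Longrightarrow> (commutator D ^^ k) (\<lambda>f. Const c * E f) =
      (\<lambda>f. Const c * (commutator D ^^ k) E f)"
proof -
  note D' = u_sub_derivation[OF D]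
  show 1: "(commutator D ^^ k) E \<in> u_sub n i" if "1 \<le> i" "E \<in> u_sub n i" for E i k
    using that by (induction k) (auto intro: u_sub_commutator D)
  show "(commutator D ^^ k) (\<lambda>f. 0) = (\<lambda>f. 0)"
    by (induction k) (auto simp: commutator_0[OF D'])
  have 2: "(commutator D ^^ k) E \<in> derivations n" if "E \<in> u_sub n 1" for E k
    using 1[OF order_refl that] by (rule u_sub_derivation)
  show "(commutator D ^^ k) (\<lambda>f. E f + F f) =
      (\<lambda>f. (commutator D ^^ k) E f + (commutator D ^^ k) F f)" if "E \<in> u_sub n 1" "F \<in> u_sub n 1"
    by (induction k) (simp_all add: commutator_linear(1)[OF D' 2[OF that(1)] 2[OF that(2)]])
  show "(commutator D ^^ k) (\<lambda>f. Const c * E f) = (\<lambda>f. Const c * (commutator D ^^ k) E f)"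
    if "E \<in> u_sub n 1"
    by (induction k) (simp_all add: commutator_linear(2)[OF D' 2[OF that] 2[OF that]])
qed

text \<open>On the leading coefficient \<open>E x\<^sub>i\<close> of \<open>E \<in> u\<^bsub>n,i\<^esub>\<close> the operator \<open>ad D\<close> acts as \<open>D\<close>, since \<open>E\<close>
  kills \<open>D x\<^sub>i \<in> P\<^bsub>i-1\<^esub>\<close>. So a power of \<open>ad D\<close> moves \<open>E\<close> into \<open>u\<^bsub>n,i+1\<^esub>\<close>.\<close>

lemma adjoint_locally_nilpotent:
  fixes D :: "'a::field mpoly \<Rightarrow> 'a mpoly"
  assumes D: "D \<in> u_sub n 1"
  shows "1 \<le> i \<Longrightarrow> E \<in> u_sub n i \<Longrightarrow> \<exists>k. (commutator D ^^ k) E = (\<lambda>f. 0)"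
proof (induction "Suc n - i" arbitrary: i E)
  case 0
  then have "E \<in> derivations n" "\<forall>j\<in>{1..n}. E (Var j) = 0" by (auto simp: u_sub_iff)
  moreover have "(\<lambda>f. 0) \<in> derivations n" by (simp add: derivations_def polys_0)
  ultimately have "E = (\<lambda>f. 0)" by (intro derivation_eqI) auto
  then have "(commutator D ^^ 0) E = (\<lambda>f. 0)" by simp
  then show ?case by blast
next
  case (Suc m)
  have i: "i \<in> {1..n}" using Suc by auto
  then have i1: "i - 1 < i" "i - 1 \<le> n" by auto
  have Ei: "(commutator D ^^ k) E \<in> u_sub n i" for k
    using funpow_commutator(1)[OF D Suc.prems] .
  have val: "(commutator D ^^ k) E (Var i) = (D ^^ k) (E (Var i))" for k
  proof (induction k)
    case (Suc k)
    have "D (Var i) \<in> polys (i - 1)" using D i by (auto simp: u_sub_iff)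
    then have "(commutator D ^^ k) E (D (Var i)) = 0"
      by (rule u_sub_vanish[OF Ei i1])
    then show ?case using Suc by (simp add: commutator_def[of D "(commutator D ^^ k) E"])
  qed simp
  have "E (Var i) \<in> polys (i - 1)" using Suc.prems i by (auto simp: u_sub_iff)
  then obtain k where "(D ^^ k) (E (Var i)) = 0"
    using u_locally_nilpotent[OF D i1(2)] by blast
  then have "(commutator D ^^ k) E (Var i) = 0" by (simp add: val)
  then have "(commutator D ^^ k) E \<in> u_sub n (Suc i)"
    using Ei[of k] Suc.prems(1) by (auto simp: u_sub_iff less_Suc_eq)
  moreover have "m = Suc n - Suc i" using Suc.hyps(2) by simp
  ultimately obtain l where "(commutator D ^^ l) ((commutator D ^^ k) E) = (\<lambda>f. 0)"
    using Suc.hyps(1)[of "Suc i"] by auto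
  then have "(commutator D ^^ (l + k)) E = (\<lambda>f. 0)" by (simp add: funpow_add)
  then show ?case by blast
qed

lemma u_sub_2_mult:
  assumes Q: "Q \<in> polys 1" and E: "E \<in> u_sub n 2" and "1 \<le> n"
  shows "(\<lambda>f. Q * E f) \<in> u_sub n 2"
proof -
  have E': "E \<in> derivations n" by (rule u_sub_derivation[OF E])
  have Qj: "Q \<in> polys j" if "1 \<le> j" for j using Q polys_mono[OF that] by blast
  have "(\<lambda>f. Q * E f) \<in> derivations n"
    using Qj[OF \<open>1 \<le> n\<close>] derivations_simps[OF E'] unfolding derivations_def
    by (auto simp: polys_mult algebra_simps)
  moreover have "Q * E (Var j) \<in> polys (j - 1)" if "j \<in> {1..n}" for j
    using E that Qj[of "j - 1"] by (cases "j < 2") (auto simp: u_sub_iff polys_0 intro!: polys_mult)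
  ultimately show ?thesis using E by (auto simp: u_sub_iff)
qed

lemma u_sub_diff:
  "1 \<le> i \<Longrightarrow> D \<in> u_sub n i \<Longrightarrow> E \<in> u_sub n i \<Longrightarrow> (\<lambda>f. D f - E f) \<in> u_sub n i"
  for D E :: "'a::field mpoly \<Rightarrow> 'a mpoly"
proof -
  assume *: "1 \<le> i" "D \<in> u_sub n i" "E \<in> u_sub n i"
  have S: "\<forall>D\<in>u_sub n i. \<forall>E\<in>u_sub n i. (\<lambda>f. D f + E f) \<in> (u_sub n i :: ('a mpoly \<Rightarrow> _) set)"
    "\<forall>c. \<forall>D\<in>u_sub n i. (\<lambda>f. Const c * D f) \<in> (u_sub n i :: ('a mpoly \<Rightarrow> _) set)"
    using submodule_u_sub[OF *(1), of n, where ?'a='a] unfolding submodule_u_alg_iff by simp_all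
  from S(1)[rule_format, OF *(2) S(2)[rule_format, OF *(3), of "- 1"]]
  have "(\<lambda>f. D f + Const (- 1) * E f) \<in> u_sub n i" .
  then show ?thesis by (simp add: single_uminus)
qed

text \<open>Integration by parts: if \<open>Q\<close> is an antiderivative of \<open>q = c x\<^sub>1\<^sup>k\<close>, then
  \<open>[D, QE] = qE + Q[D, E]\<close>, so solving for \<open>qE\<close> is reduced to solving for \<open>Q[D, E]\<close>, where
  \<open>[D, E]\<close> is nearer to being killed by \<open>ad D\<close>.\<close>

lemma adjoint_surjective:
  fixes D :: "'a::field_char_0 mpoly \<Rightarrow> 'a mpoly"
  assumes D: "D \<in> u_sub n 1" and D1: "D (Var 1) = 1" and n: "1 \<le> n" and E: "E \<in> u_sub n 2"
  shows "\<exists>G\<in>u_sub n 2. commutator D G = E"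
proof -
  note D' = u_sub_derivation[OF D]
  have *: "\<exists>G\<in>u_sub n 2. commutator D G = (\<lambda>f. (Const c * Var 1 ^ k) * E f)"
    if "E \<in> u_sub n 2" "(commutator D ^^ N) E = (\<lambda>f. 0)" for N E c k
    using that
  proof (induction N arbitrary: E c k)
    case 0
    then have "commutator D E = (\<lambda>f. (Const c * Var 1 ^ k) * E f)" by (simp add: commutator_0[OF D'])
    then show ?case using 0 by blast
  next
    case (Suc N)
    define Q :: "'a mpoly" where "Q = Const (c / of_nat (Suc k)) * Var 1 ^ Suc k"
    have Q: "Q \<in> polys 1" "Q \<in> polys n"
      using n by (auto simp: Q_def intro!: polys_mult polys_Const polys_power polys_Var)
    have x: "(Var 1 :: 'a mpoly) ^ k \<in> polys n" for k
      using n by (intro polys_power polys_Var) auto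
    have "D Q = Const (c / of_nat (Suc k)) * (of_nat (Suc k) * Var 1 ^ k)"
      unfolding Q_def derivations_simps(4)[OF D' x]
      using derivation_power[OF D' polys_Var[of 1 n], of k] n D1 by simp
    also have "\<dots> = Const (c / of_nat (Suc k) * of_nat (Suc k)) * Var 1 ^ k"
      by (simp only: mult.assoc[symmetric] single_of_nat[symmetric] mult_single add_0)
    finally have DQ: "D Q = Const c * Var 1 ^ k" by (simp del: of_nat_Suc)
    have E1: "E \<in> u_sub n 1" using Suc.prems(1) u_sub_mono[of 1 2 n] by auto
    have "commutator D E \<in> u_sub n 2" using u_sub_commutator[OF _ D Suc.prems(1)] by simp
    moreover have "(commutator D ^^ N) (commutator D E) = (\<lambda>f. 0)"
      using Suc.prems(2) by (simp add: funpow_Suc_right del: funpow.simps)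
    ultimately obtain G where G: "G \<in> u_sub n 2" "commutator D G = (\<lambda>f. Q * commutator D E f)"
      using Suc.IH unfolding Q_def by blast
    have H: "(\<lambda>f. Q * E f) \<in> u_sub n 2" by (rule u_sub_2_mult[OF Q(1) Suc.prems(1) n])
    have "commutator D (\<lambda>f. Q * E f) = (\<lambda>f. D Q * E f + Q * commutator D E f)"
      using derivations_simps(5)[OF D' Q(2) derivation_range[OF u_sub_derivation[OF E1]]]
      by (simp add: commutator_def algebra_simps)
    then have "commutator D (\<lambda>f. Q * E f - G f) = (\<lambda>f. D Q * E f)"
      using commutator_linear(3)[OF D' u_sub_derivation[OF H] u_sub_derivation[OF G(1)]] G(2) by simp
    then show ?case using u_sub_diff[OF _ H G(1)] DQ by auto
  qed
  have "E \<in> u_sub n 1" using E u_sub_mono[of 1 2 n] by auto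
  then obtain N where "(commutator D ^^ N) E = (\<lambda>f. 0)"
    using adjoint_locally_nilpotent[OF D, of 1] by auto
  from *[OF E this, of 1 0] show ?thesis by simp
qed

section \<open>Proper and co-finite ideals\<close>

text \<open>The vector field \<open>q\<partial>\<^sub>i\<close> on \<open>P\<^sub>n\<close>.\<close>

definition vfield :: "nat \<Rightarrow> nat \<Rightarrow> 'a::comm_ring_1 mpoly \<Rightarrow> 'a mpoly \<Rightarrow> 'a mpoly" where
  "vfield n i q = (\<lambda>f. q * \<partial> n i f)"

lemma vfield_Var: "1 \<le> j \<Longrightarrow> j \<le> n \<Longrightarrow> vfield n i q (Var j) = (if i = j then q else 0)"
  by (simp add: vfield_def partial_def polys_Var pdiff_Var)

lemma vfield_u_sub: "1 \<le> i \<Longrightarrow> i \<le> n \<Longrightarrow> q \<in> polys (i - 1) \<Longrightarrow> vfield n i q \<in> u_sub n i"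
  unfolding u_sub_def vfield_def
  by (rule CollectI, rule exI[of _ "\<lambda>j. if j = i then q else 0"])
    (auto simp: polys_0 if_distrib[of "\<lambda>x. x * _"] cong: if_cong)

lemma vfield_u: "1 \<le> i \<Longrightarrow> i \<le> n \<Longrightarrow> q \<in> polys (i - 1) \<Longrightarrow> vfield n i q \<in> u_sub n 1"
  using vfield_u_sub[of i n q] u_sub_mono[of 1 i n] by auto

locale u_ideal =
  fixes n :: nat and I :: "('a::field_char_0 mpoly \<Rightarrow> 'a mpoly) set"
  assumes ideal: "lie_ideal class_ring (u_alg n) I"
begin

lemma submodule: "submodule class_ring I (u_alg n)"
  using ideal by (simp add: lie_ideal_def)

lemma subset: "D \<in> I \<Longrightarrow> D \<in> u_sub n 1"
  and zero: "(\<lambda>f. 0) \<in> I"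
  and add: "D \<in> I \<Longrightarrow> E \<in> I \<Longrightarrow> (\<lambda>f. D f + E f) \<in> I"
  and smult: "D \<in> I \<Longrightarrow> (\<lambda>f. Const c * D f) \<in> I"
  using submodule unfolding submodule_u_alg_iff by auto

lemma commutator_right: "D \<in> u_sub n 1 \<Longrightarrow> E \<in> I \<Longrightarrow> commutator D E \<in> I"
  using ideal by (simp add: lie_ideal_def u_alg_simps)

lemma commutator_left: "E \<in> I \<Longrightarrow> D \<in> u_sub n 1 \<Longrightarrow> commutator E D \<in> I"
  using smult[OF commutator_right, of D E "- 1"] by (simp add: commutator_def single_uminus)

text \<open>A multiple \<open>D\<close> of an element of \<open>I\<close> outside \<open>u\<^bsub>n,2\<^esub>\<close> has \<open>D x\<^sub>1 = 1\<close>, and \<open>u\<^sub>n = KD + [D, u\<^bsub>n,2\<^esub>]\<close>.\<close>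

lemma eq_u_sub_1:
  assumes n: "1 \<le> n" and "\<not> I \<subseteq> u_sub n 2"
  shows "I = u_sub n 1"
proof -
  obtain E where E: "E \<in> I" "E \<notin> u_sub n 2" using assms(2) by blast
  have E': "E \<in> u_sub n 1" by (rule subset[OF E(1)])
  obtain j where "j \<in> {1..n}" "j < 2" "E (Var j) \<noteq> 0"
    using E(2) E' by (auto simp: u_sub_iff)
  moreover from this have "j = 1" by simp
  ultimately have "E (Var 1) \<noteq> 0" by simp
  moreover have "E (Var 1) \<in> polys 0" using E' n unfolding u_sub_iff[OF order_refl] by force
  ultimately obtain c where c: "E (Var 1) = Const c" "c \<noteq> 0" using polys_0_Const by (metis single_zero)
  define D where "D = (\<lambda>f. Const (inverse c) * E f)"
  have D: "D \<in> I" "D (Var 1) = 1" using smult[OF E(1)] c by (auto simp: D_def mult_single)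
  have u2: "u_sub n 2 \<subseteq> I"
  proof
    fix X :: "'a mpoly \<Rightarrow> 'a mpoly" assume "X \<in> u_sub n 2"
    then obtain G where "G \<in> u_sub n 2" "commutator D G = X"
      using adjoint_surjective[OF subset[OF D(1)] D(2) n] by blast
    then show "X \<in> I" using commutator_left[OF D(1), of G] u_sub_mono[of 1 2 n] by auto
  qed
  have "X \<in> I" if X: "X \<in> u_sub n 1" for X
  proof -
    have "X (Var 1) \<in> polys 0" using X n unfolding u_sub_iff[OF order_refl] by force
    then obtain b where b: "X (Var 1) = Const b" using polys_0_Const by blast
    define Y where "Y = (\<lambda>f. X f - Const b * D f)"
    have "Y \<in> u_sub n 1" unfolding Y_def
      using u_sub_diff[OF order_refl X subset[OF smult[OF D(1)]]] .
    moreover have "Y (Var j) = 0" if "1 \<le> j" "j < 2" for j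
    proof -
      have "j = 1" using that by simp
      then show ?thesis using b D(2) by (simp add: Y_def)
    qed
    ultimately have "Y \<in> u_sub n 2" by (auto simp: u_sub_iff)
    then have "(\<lambda>f. Y f + Const b * D f) \<in> I" using u2 by (intro add smult D) auto
    then show ?thesis by (simp add: Y_def)
  qed
  then show ?thesis using subset by blast
qed

text \<open>With \<open>T = ad \<partial>\<^sub>1\<close> and \<open>N d = T\<^sup>-\<^sup>d(I)\<close>, let \<open>N (d + 1) = N d\<close>. If \<open>TE \<in> I\<close>, write \<open>E = T\<^sup>dF\<close>;
  then \<open>F \<in> N (d + 1)\<close>, so \<open>F \<in> N d\<close>, that is \<open>E \<in> I\<close>. Thus membership in \<open>I\<close> is inherited
  backwards from \<open>T\<^sup>kE = 0\<close> to \<open>E\<close>.\<close>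

lemma cofinite_imp_u_sub_2_subset:
  assumes n: "1 \<le> n" and cofin: "cofinite_in class_ring (u_alg n) I"
  shows "u_sub n 2 \<subseteq> I"
proof
  define D :: "'a mpoly \<Rightarrow> 'a mpoly" where "D = vfield n 1 1"
  have D: "D \<in> u_sub n 1" "D (Var 1) = 1"
    using n by (auto simp: D_def vfield_Var polys_1 intro!: vfield_u_sub)
  note T = funpow_commutator[OF D(1)]
  define N where "N d = {E \<in> u_sub n 1. (commutator D ^^ d) E \<in> I}" for d
  have sub: "submodule class_ring (N d) (u_alg n)" for d
    using submodule_u_sub[of 1 n, where ?'a='a] unfolding submodule_u_alg_iff N_def
    by (auto simp: T(2-4) zero add smult)
  have le: "I \<subseteq> N d" for d
  proof -
    have "(commutator D ^^ d) E \<in> I" if "E \<in> I" for E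
      using that by (induction d) (auto intro: commutator_right[OF D(1)])
    then show ?thesis using subset by (auto simp: N_def)
  qed
  have mono: "N d \<subseteq> N (Suc d)" for d
    by (auto simp: N_def intro: commutator_right[OF D(1)])
  obtain d where d: "N (Suc d) \<subseteq> N d"
  proof (rule ccontr)
    assume *: "\<not> thesis"
    have strict: "N d \<subset> N (Suc d)" for d using * that mono[of d] by blast
    have "k \<le> vectorspace.dim class_ring (quot_vs (u_alg n) I)" for k
      by (rule strict_chain_mod_submodule[OF vectorspace_u submodule cofin, of k N, OF sub le strict])
    then show False using not_less_eq_eq by blast
  qed
  have step: "E \<in> I" if E: "E \<in> u_sub n 2" "commutator D E \<in> I" for E
  proof -
    have "\<exists>F\<in>u_sub n 2. (commutator D ^^ k) F = E" for k
    proof (induction k)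
      case (Suc k)
      then obtain F where "F \<in> u_sub n 2" "(commutator D ^^ k) F = E" by blast
      then show ?case using adjoint_surjective[OF D n, of F]
        by (auto simp: funpow_Suc_right simp del: funpow.simps)
    qed (use E in auto)
    then obtain F where F: "F \<in> u_sub n 2" "(commutator D ^^ d) F = E" by blast
    have "F \<in> N (Suc d)" using F E(2) u_sub_mono[of 1 2 n] by (auto simp: N_def)
    then show ?thesis using d F(2) by (auto simp: N_def)
  qed
  fix E :: "'a mpoly \<Rightarrow> 'a mpoly" assume E: "E \<in> u_sub n 2"
  then obtain k where "(commutator D ^^ k) E = (\<lambda>f. 0)"
    using adjoint_locally_nilpotent[OF D(1), of 2] by auto
  then have "(commutator D ^^ k) E \<in> I" using zero by simp
  then show "E \<in> I"
  proof (induction k)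
    case (Suc k)
    have "(commutator D ^^ k) E \<in> u_sub n 2" by (rule T(1)) (use E in auto)
    then show ?case using Suc step by simp
  qed simp
qed

end

section \<open>The centre\<close>

lemma lie_ideal_u_iff:
  "lie_ideal class_ring (u_alg n :: ('a::field, _) lie_alg) I \<longleftrightarrow>
    submodule class_ring I (u_alg n) \<and> (\<forall>D\<in>u_sub n 1. \<forall>E\<in>I. commutator D E \<in> I)"
  by (simp add: lie_ideal_def u_alg_simps)

lemma commutator_swap: "commutator E D = (\<lambda>f. - commutator D E f)"
  by (simp add: commutator_def)

lemma vfield_linear:
  "vfield n i (p + q) = (\<lambda>f. vfield n i p f + vfield n i q f)"
  "vfield n i (Const c * q) = (\<lambda>f. Const c * vfield n i q f)"
  "vfield n i 0 = (\<lambda>f. 0)"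
  by (simp_all add: vfield_def distrib_right mult.assoc)

lemma vfield_eq_iff: "1 \<le> n \<Longrightarrow> vfield n n p = vfield n n q \<longleftrightarrow> p = q"
  using vfield_Var[of n n n p] vfield_Var[of n n n q] by (metis order_refl)

lemma vfield_eq_0_iff: "1 \<le> n \<Longrightarrow> vfield n n p = (\<lambda>f. 0) \<longleftrightarrow> p = 0"
  using vfield_eq_iff[of n p 0] by (simp add: vfield_linear(3))

lemma u_sub_last:
  assumes n: "1 \<le> n" and E: "E \<in> u_sub n n"
  shows "E = vfield n n (E (Var n))" "E (Var n) \<in> polys (n - 1)"
proof -
  show *: "E (Var n) \<in> polys (n - 1)" using E n by (simp add: u_sub_iff)
  show "E = vfield n n (E (Var n))"
  proof (rule derivation_eqI)
    show "E \<in> derivations n" by (rule u_sub_derivation[OF E])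
    show "vfield n n (E (Var n)) \<in> derivations n"
      by (rule u_sub_derivation[OF vfield_u_sub[OF n order_refl *]])
    show "E (Var j) = vfield n n (E (Var n)) (Var j)" if "1 \<le> j" "j \<le> n" for j
      using that E n by (cases "j = n") (simp_all add: vfield_Var u_sub_iff)
  qed
qed

lemma u_sub_lastI:
  assumes "1 \<le> n" "E \<in> u_sub n 1" "\<And>j. 1 \<le> j \<Longrightarrow> j < n \<Longrightarrow> E (Var j) = 0"
  shows "E \<in> u_sub n n"
  using assms by (simp add: u_sub_iff)

text \<open>No element of \<open>u\<^sub>n\<close> has coefficients that involve \<open>x\<^sub>n\<close>, so \<open>\<partial>\<^sub>n\<close> commutes with all of \<open>u\<^sub>n\<close>.\<close>

lemma commutator_vfield_last:
  fixes D :: "'a::field mpoly \<Rightarrow> 'a mpoly"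
  assumes n: "1 \<le> n" and D: "D \<in> u_sub n 1" and q: "q \<in> polys (n - 1)"
  shows "commutator D (vfield n n q) = vfield n n (D q)"
proof -
  have vq: "vfield n n q \<in> u_sub n n" by (rule vfield_u_sub[OF n order_refl q])
  have E: "commutator D (vfield n n q) \<in> u_sub n n" by (rule u_sub_commutator[OF n D vq])
  have "D (Var n) \<in> polys (n - 1)" using D n by (simp add: u_sub_iff)
  then have "vfield n n q (D (Var n)) = 0"
    using n by (intro u_sub_vanish[OF vq, of "n - 1"]) auto
  then have "commutator D (vfield n n q) (Var n) = D q"
    using n by (simp add: commutator_def vfield_Var)
  then show ?thesis using u_sub_last(1)[OF n E] by simp
qed

lemma vfield_apply: "q \<in> polys n \<Longrightarrow> vfield n i p q = p * pdiff i q"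
  by (simp add: vfield_def partial_def)

text \<open>In characteristic \<open>0\<close> a polynomial that is not constant has a nonzero partial derivative, and its
  degree is smaller.\<close>

lemma exists_constant_pdiff:
  fixes q :: "'a::field_char_0 mpoly"
  assumes closed: "\<And>i q. 1 \<le> i \<Longrightarrow> i \<le> k \<Longrightarrow> q \<in> polys k \<Longrightarrow> P q \<Longrightarrow> P (pdiff i q)"
    and "P q" "q \<in> polys k" "q \<noteq> 0"
  shows "\<exists>c. c \<noteq> 0 \<and> P (Const c)"
proof -
  define deg where "deg m = (\<Sum>j\<in>{1..k}. Poly_Mapping.lookup m j)" for m :: "nat \<Rightarrow>\<^sub>0 nat"
  have *: "\<exists>c. c \<noteq> 0 \<and> P (Const c)"
    if "\<forall>m\<in>Poly_Mapping.keys q. deg m < d" "P q" "q \<in> polys k" "q \<noteq> 0" for d q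
    using that
  proof (induction d arbitrary: q)
    case 0
    then show ?case by (metis keys_eq_empty ex_in_conv not_less_zero)
  next
    case (Suc d)
    show ?case
    proof (cases "Poly_Mapping.keys q \<subseteq> {0}")
      case True
      then have "q = Const (Poly_Mapping.lookup q 0)"
        by (intro poly_mapping_eqI) (auto simp: lookup_single when_def in_keys_iff)
      then show ?thesis using Suc.prems(2,4) by (metis single_zero)
    next
      case False
      then obtain m i where m: "m \<in> Poly_Mapping.keys q" "i \<in> Poly_Mapping.keys m"
        by (metis keys_eq_empty ex_in_conv singleton_iff subsetI)
      then have i: "i \<in> {1..k}" using Suc.prems(3) unfolding polys_def by blast
      have "deg m' < d" if "m' \<in> Poly_Mapping.keys (pdiff i q)" for m'
      proof -
        have "m' + Poly_Mapping.single i 1 \<in> Poly_Mapping.keys q"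
          using that by (auto simp: in_keys_iff lookup_pdiff)
        then have "deg (m' + Poly_Mapping.single i 1) < Suc d" using Suc.prems(1) by blast
        moreover have "deg (m' + Poly_Mapping.single i 1) = deg m' + 1"
          using i by (simp add: deg_def lookup_add sum.distrib lookup_single when_def)
        ultimately show ?thesis by simp
      qed
      then show ?thesis
        using Suc.IH[of "pdiff i q"] closed[of i q] i Suc.prems(2,3) pdiff_nonzero[OF m]
          pdiff_polys[OF Suc.prems(3), of i]
        by auto
    qed
  qed
  have "finite (deg ` Poly_Mapping.keys q)" by simp
  then obtain d where "\<forall>m\<in>Poly_Mapping.keys q. deg m < d"
    unfolding finite_nat_set_iff_bounded by blast
  then show ?thesis using * assms(2-) by blast
qed

text \<open>If \<open>E x\<^sub>j \<noteq> 0\<close> for some \<open>j < n\<close>, then \<open>[E, x\<^sub>j\<partial>\<^sub>n] = E(x\<^sub>j)\<partial>\<^sub>n\<close>; otherwise \<open>E\<close> is itself a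
  multiple of \<open>\<partial>\<^sub>n\<close>. So some nonzero \<open>q\<partial>\<^sub>n\<close> is in \<open>I\<close>, and \<open>[\<partial>\<^sub>i, q\<partial>\<^sub>n] = \<partial>\<^sub>i(q)\<partial>\<^sub>n\<close>
  for \<open>i < n\<close> reduces \<open>q\<close> to a constant.\<close>

lemma (in u_ideal) K_partial_subset:
  assumes n: "1 \<le> n" and "I \<noteq> {\<lambda>f. 0}"
  shows "K_partial n \<subseteq> I"
proof -
  obtain E where E: "E \<in> I" "E \<noteq> (\<lambda>f. 0)" using assms(2) zero by blast
  have "\<exists>q. vfield n n q \<in> I \<and> q \<in> polys (n - 1) \<and> q \<noteq> 0"
  proof (cases "\<forall>j. 1 \<le> j \<longrightarrow> j < n \<longrightarrow> E (Var j) = 0")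
    case True
    then have "E \<in> u_sub n n" using u_sub_lastI[OF n subset[OF E(1)]] by blast
    note * = u_sub_last[OF n this]
    then show ?thesis using E vfield_eq_0_iff[OF n] by metis
  next
    case False
    then obtain j where j: "1 \<le> j" "j < n" "E (Var j) \<noteq> 0" by blast
    have x: "Var j \<in> polys (n - 1)" using j by (intro polys_Var) auto
    have "commutator E (vfield n n (Var j)) \<in> I"
      by (rule commutator_left[OF E(1) vfield_u[OF n order_refl x]])
    then have "vfield n n (E (Var j)) \<in> I"
      unfolding commutator_vfield_last[OF n subset[OF E(1)] x] .
    moreover have "E (Var j) \<in> polys (n - 1)"
      by (rule u_sub_polys[OF subset[OF E(1)] _ x]) simp
    ultimately show ?thesis using j(3) by blast
  qed
  then obtain q where q: "vfield n n q \<in> I" "q \<in> polys (n - 1)" "q \<noteq> 0" by blast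
  have "\<exists>c. c \<noteq> 0 \<and> vfield n n (Const c) \<in> I"
  proof (rule exists_constant_pdiff[where P = "\<lambda>q. vfield n n q \<in> I", OF _ q])
    fix i and p :: "'a mpoly" assume i: "1 \<le> i" "i \<le> n - 1" and p: "p \<in> polys (n - 1)" "vfield n n p \<in> I"
    have D: "vfield n i (1 :: 'a mpoly) \<in> u_sub n 1" using i by (intro vfield_u polys_1) auto
    have "p \<in> polys n" using p(1) polys_mono[of "n - 1" n] by auto
    then have "vfield n i 1 p = pdiff i p" by (simp add: vfield_apply)
    then show "vfield n n (pdiff i p) \<in> I"
      using commutator_right[OF D p(2)] commutator_vfield_last[OF n D p(1)] by simp
  qed
  then obtain c where c: "c \<noteq> 0" "vfield n n (Const c) \<in> I" by blast
  show ?thesis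
  proof
    fix X :: "'a mpoly \<Rightarrow> 'a mpoly" assume "X \<in> K_partial n"
    then obtain b where X: "X = vfield n n (Const b)" by (auto simp: K_partial_def vfield_def)
    have "Const (b / c) * Const c = Const b" using c(1) by (simp add: mult_single)
    then show "X \<in> I" using smult[OF c(2), of "b / c"] vfield_linear(2)[of n n "b / c" "Const c"]
      by (simp add: X)
  qed
qed

text \<open>Commuting with \<open>x\<^sub>j\<partial>\<^sub>n\<close> for \<open>j < n\<close> forces \<open>z = q\<partial>\<^sub>n\<close>, and commuting with
  \<open>\<partial>\<^sub>1, \<dots>, \<partial>\<^bsub>n-1\<^esub>\<close> forces \<open>q\<close> to be constant.\<close>

lemma centre_eq_K_partial:
  assumes n: "1 \<le> n"
  shows "lie_centre (u_alg n :: ('a::field_char_0, _) lie_alg) = K_partial n"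
proof (intro equalityI subsetI)
  fix z :: "'a mpoly \<Rightarrow> 'a mpoly" assume "z \<in> lie_centre (u_alg n)"
  then have z: "z \<in> u_sub n 1" and central: "\<And>x. x \<in> u_sub n 1 \<Longrightarrow> commutator z x = (\<lambda>f. 0)"
    by (auto simp: lie_centre_def u_alg_simps)
  have "z (Var j) = 0" if j: "1 \<le> j" "j < n" for j
  proof -
    have x: "Var j \<in> polys (n - 1)" using j by (intro polys_Var) auto
    have "vfield n n (z (Var j)) = (\<lambda>f. 0)"
      using central[OF vfield_u[OF n order_refl x]] commutator_vfield_last[OF n z x] by simp
    then show ?thesis using vfield_eq_0_iff[OF n] by blast
  qed
  then have "z \<in> u_sub n n" using u_sub_lastI[OF n z] by blast
  then obtain q where q: "z = vfield n n q" "q \<in> polys (n - 1)" using u_sub_last[OF n] by blast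
  have "pdiff i q = 0" if i: "1 \<le> i" "i \<le> n - 1" for i
  proof -
    have D: "vfield n i (1 :: 'a mpoly) \<in> u_sub n 1" using i by (intro vfield_u polys_1) auto
    have "q \<in> polys n" using q(2) polys_mono[of "n - 1" n] by auto
    then have "vfield n i 1 q = pdiff i q" by (simp add: vfield_apply)
    moreover have "commutator (vfield n i 1) z = (\<lambda>f. 0)"
      unfolding commutator_swap[of "vfield n i 1" z] central[OF D] by simp
    ultimately have "vfield n n (pdiff i q) = (\<lambda>f. 0)"
      using commutator_vfield_last[OF n D q(2)] by (simp add: q(1))
    then show ?thesis using vfield_eq_0_iff[OF n] by blast
  qed
  then have "Poly_Mapping.keys m = {}" if "m \<in> Poly_Mapping.keys q" for m
    using q(2) that pdiff_nonzero[OF that] by (fastforce simp: polys_def)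
  then have "q \<in> polys 0" by (simp add: polys_def)
  then show "z \<in> K_partial n"
    using polys_0_Const[of q] by (auto simp: q(1) K_partial_def vfield_def)
next
  fix z :: "'a mpoly \<Rightarrow> 'a mpoly" assume "z \<in> K_partial n"
  then obtain c where z: "z = vfield n n (Const c)" by (auto simp: K_partial_def vfield_def)
  have "commutator z x = (\<lambda>f. 0)" if x: "x \<in> u_sub n 1" for x
    unfolding z commutator_swap[of "vfield n n (Const c)" x]
      commutator_vfield_last[OF n x polys_Const] derivation_Const[OF u_sub_derivation[OF x]]
    by (simp add: vfield_linear(3))
  then show "z \<in> lie_centre (u_alg n)"
    using vfield_u[OF n order_refl polys_Const, of c] by (simp add: lie_centre_def u_alg_simps z)
qed

section \<open>Finite-dimensional ideals\<close>

lemma lookup_monomial_mult: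
  "Poly_Mapping.lookup (Poly_Mapping.single a c * f) (a + k) = c * Poly_Mapping.lookup f k"
  for f :: "'a::comm_ring_1 mpoly"
proof -
  have "Poly_Mapping.single a c * f =
      (\<Sum>m\<in>Poly_Mapping.keys f. Poly_Mapping.single (a + m) (c * Poly_Mapping.lookup f m))"
    by (subst poly_sum_singles[of f, symmetric]) (simp add: sum_distrib_left mult_single)
  then show ?thesis
    by (simp add: lookup_sum lookup_single when_def sum.delta in_keys_iff)
qed

lemma lookup_Const_mult: "Poly_Mapping.lookup (Const c * f) k = c * Poly_Mapping.lookup f k"
  for f :: "'a::comm_ring_1 mpoly"
  using lookup_monomial_mult[of 0 c f k] by simp

lemma Var_power: "(Var i :: 'a::comm_ring_1 mpoly) ^ k = Poly_Mapping.single (Poly_Mapping.single i k) 1"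
  by (induction k) (simp_all add: mult_single single_add[symmetric] One_nat_def)

text \<open>Let \<open>e\<close> be the degree of \<open>f\<close> in \<open>x\<^sub>i\<close>. The element \<open>x\<^sub>i\<^sup>df\<partial>\<^sub>n\<close> has degree exactly \<open>e + d\<close>, so
  the elements of \<open>I\<close> of degree less than \<open>e + d\<close>, \<open>d \<ge> 0\<close>, form a strict chain of subspaces.\<close>

lemma (in u_ideal) finite_dim_no_powers:
  assumes n: "1 \<le> n" and fin: "finite_dim_in class_ring (u_alg n) I"
    and powers: "\<And>k. vfield n n (Var i ^ k * f) \<in> I"
  shows "f = 0"
proof (rule ccontr)
  assume "f \<noteq> 0"
  define e where "e = Max ((\<lambda>m. Poly_Mapping.lookup m i) ` Poly_Mapping.keys f)"
  have ne: "Poly_Mapping.keys f \<noteq> {}" using \<open>f \<noteq> 0\<close> by simp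
  then have "e \<in> (\<lambda>m. Poly_Mapping.lookup m i) ` Poly_Mapping.keys f"
    unfolding e_def by (intro Max_in) auto
  then obtain m where m: "m \<in> Poly_Mapping.keys f" "Poly_Mapping.lookup m i = e" by auto
  have le: "Poly_Mapping.lookup k i \<le> e" if "k \<in> Poly_Mapping.keys f" for k
    using that unfolding e_def by (intro Max_ge) auto
  define N where "N d = {E \<in> I. \<forall>k\<in>Poly_Mapping.keys (E (Var n)). Poly_Mapping.lookup k i < e + d}" for d
  have sub: "submodule class_ring (N d) (u_alg n)" for d
    unfolding submodule_u_alg_iff
  proof (intro conjI ballI allI)
    show "N d \<subseteq> u_sub n 1" using subset by (auto simp: N_def)
    show "(\<lambda>f. 0) \<in> N d" using zero by (simp add: N_def)
    show "(\<lambda>f. D f + E f) \<in> N d" if "D \<in> N d" "E \<in> N d" for D E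
      using that add Poly_Mapping.keys_add[of "D (Var n)" "E (Var n)"] by (auto simp: N_def)
    show "(\<lambda>f. Const c * D f) \<in> N d" if "D \<in> N d" for c D
      using that smult by (auto simp: N_def in_keys_iff lookup_Const_mult)
  qed
  have strict: "N d \<subset> N (Suc d)" for d
  proof -
    let ?q = "Var i ^ d * f"
    have v: "vfield n n ?q (Var n) = ?q" using n by (simp add: vfield_Var)
    have "Poly_Mapping.lookup k i < e + Suc d" if k: "k \<in> Poly_Mapping.keys ?q" for k
    proof -
      obtain a l where "k = a + l" "a \<in> Poly_Mapping.keys (Var i ^ d :: 'a mpoly)" "l \<in> Poly_Mapping.keys f"
        using k keys_mult[of "Var i ^ d" f] by blast
      then show ?thesis using le[of l] by (simp add: Var_power lookup_add)
    qed
    then have "vfield n n ?q \<in> N (Suc d)" using powers by (auto simp: N_def v)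
    moreover have "Poly_Mapping.single i d + m \<in> Poly_Mapping.keys ?q"
      using m(1) by (simp add: Var_power in_keys_iff lookup_monomial_mult)
    then have "vfield n n ?q \<notin> N d"
      using m(2) by (auto simp: N_def v lookup_add intro!: bexI[of _ "Poly_Mapping.single i d + m"])
    moreover have "N d \<subseteq> N (Suc d)" by (auto simp: N_def less_Suc_eq)
    ultimately show ?thesis by blast
  qed
  have "N d \<subseteq> I" for d by (auto simp: N_def)
  then have "k \<le> vectorspace.dim class_ring ((u_alg n)\<lparr>carrier := I\<rparr>)" for k
    by (intro strict_chain_in_submodule[OF vectorspace_u submodule fin, of k N] sub strict)
  then show False using not_less_eq_eq by blast
qed

text \<open>The polynomials in \<open>x\<^sub>1\<close> of degree less than \<open>s\<close>. A bound on exponents is easier to handle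
  than the sums in the definition of \<open>I\<^sub>s\<close>; they agree by lemma \<open>I_ideal_eq\<close>.\<close>

definition x1_polys :: "nat \<Rightarrow> 'a::zero mpoly set" where
  "x1_polys s = {q \<in> polys 1. \<forall>m\<in>Poly_Mapping.keys q. Poly_Mapping.lookup m 1 < s}"

lemma x1_monomial:
  assumes "q \<in> polys 1" "m \<in> Poly_Mapping.keys q"
  shows "m = Poly_Mapping.single 1 (Poly_Mapping.lookup m 1)"
proof -
  have "Poly_Mapping.keys m \<subseteq> {1}" using assms by (auto simp: polys_def)
  then show ?thesis by (intro poly_mapping_eqI) (auto simp: lookup_single when_def in_keys_iff)
qed

lemma I_ideal_eq: "I_ideal n s = vfield n n ` (x1_polys s :: 'a::comm_ring_1 mpoly set)"
proof -
  define sm where "sm c = (\<Sum>i<s. Const (c i) * Var 1 ^ i)" for c :: "nat \<Rightarrow> 'a"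
  have I: "I_ideal n s = {vfield n n (sm c) | c. True}"
    by (simp add: I_ideal_def vfield_def sm_def sum_distrib_right)
  have "sm c \<in> x1_polys s" for c
  proof -
    have "sm c \<in> polys 1"
      unfolding sm_def by (intro polys_sum polys_mult polys_Const polys_power polys_Var) auto
    moreover have "Poly_Mapping.lookup m 1 < s" if "m \<in> Poly_Mapping.keys (sm c)" for m
      using that Poly_Mapping.keys_sum[of "\<lambda>i. Const (c i) * Var 1 ^ i" "{..<s}"]
      by (auto simp: sm_def Var_power mult_single split: if_splits)
    ultimately show ?thesis by (simp add: x1_polys_def)
  qed
  moreover have "\<exists>c. q = sm c" if q: "q \<in> x1_polys s" for q
  proof (intro exI poly_mapping_eqI)
    fix m
    let ?c = "\<lambda>i. Poly_Mapping.lookup q (Poly_Mapping.single 1 i)"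
    have "Poly_Mapping.lookup (sm ?c) m =
        (\<Sum>i<s. if i = Poly_Mapping.lookup m 1 then Poly_Mapping.lookup q m when m = Poly_Mapping.single 1 (Poly_Mapping.lookup m 1) else 0)"
      unfolding sm_def lookup_sum
      by (intro sum.cong refl) (auto simp: Var_power mult_single lookup_single when_def)
    also have "\<dots> = Poly_Mapping.lookup q m"
      using q x1_monomial[of q m] by (cases "m \<in> Poly_Mapping.keys q") (auto simp: x1_polys_def in_keys_iff)
    finally show "Poly_Mapping.lookup q m = Poly_Mapping.lookup (sm ?c) m" by simp
  qed
  ultimately show ?thesis unfolding I by blast
qed

lemma x1_polys_0: "x1_polys 0 = {0}"
  by (auto simp: x1_polys_def polys_0 keys_eq_empty[symmetric] simp del: keys_eq_empty)

lemma x1_polys_closed: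
  fixes p q :: "'a::comm_ring_1 mpoly"
  shows "0 \<in> x1_polys s"
    and "p \<in> x1_polys s \<Longrightarrow> q \<in> x1_polys s \<Longrightarrow> p + q \<in> x1_polys s"
    and "q \<in> x1_polys s \<Longrightarrow> Const c * q \<in> x1_polys s"
    and "q \<in> x1_polys (Suc s) \<Longrightarrow> pdiff 1 q \<in> x1_polys s"
    and "s \<le> t \<Longrightarrow> (x1_polys s :: 'a mpoly set) \<subseteq> x1_polys t"
proof -
  show "0 \<in> x1_polys s" by (simp add: x1_polys_def polys_0)
  show "p \<in> x1_polys s \<Longrightarrow> q \<in> x1_polys s \<Longrightarrow> p + q \<in> x1_polys s"
    using Poly_Mapping.keys_add[of p q] by (auto simp: x1_polys_def polys_add)
  show "q \<in> x1_polys s \<Longrightarrow> Const c * q \<in> x1_polys s"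
    by (auto simp: x1_polys_def polys_mult polys_Const in_keys_iff lookup_Const_mult)
  show "pdiff 1 q \<in> x1_polys s" if q: "q \<in> x1_polys (Suc s)"
  proof -
    have "Poly_Mapping.lookup m 1 < s" if "m \<in> Poly_Mapping.keys (pdiff 1 q)" for m
    proof -
      have "m + Poly_Mapping.single 1 1 \<in> Poly_Mapping.keys q"
        using that by (auto simp: in_keys_iff lookup_pdiff)
      then have "Poly_Mapping.lookup (m + Poly_Mapping.single 1 1) 1 < Suc s"
        using q unfolding x1_polys_def by blast
      then show ?thesis by (simp add: lookup_add)
    qed
    then show ?thesis using q by (auto simp: x1_polys_def pdiff_polys)
  qed
  show "(x1_polys s :: 'a mpoly set) \<subseteq> x1_polys t" if "s \<le> t" using that by (auto simp: x1_polys_def)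
qed

lemma x1_polys_subset:
  assumes "2 \<le> n" "q \<in> x1_polys s"
  shows "q \<in> polys (n - 1)"
proof -
  have "1 \<le> n - 1" using assms(1) by simp
  then show ?thesis using polys_mono[of 1 "n - 1"] assms(2) unfolding x1_polys_def by blast
qed

lemma u_sub_apply_x1:
  fixes q :: "'a::comm_ring_1 mpoly"
  assumes D: "D \<in> u_sub n 1" and n: "1 \<le> n" and q: "q \<in> polys 1"
  shows "D q = D (Var 1) * pdiff 1 q"
proof -
  note D' = u_sub_derivation[OF D]
  have sub: "g \<in> polys n" if "g \<in> polys 1" for g :: "'a mpoly" using that polys_mono[OF n] by blast
  show ?thesis using q
  proof (induction rule: polys_induct)
    case (Const c)
    then show ?case by (simp add: derivation_Const[OF D'] pdiff_single)
  next
    case (Var j)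
    then have "j = 1" by simp
    then show ?case by (simp add: pdiff_Var)
  qed (simp_all add: derivations_simps[OF D'] sub pdiff_add pdiff_mult algebra_simps)
qed

text \<open>On \<open>K[x\<^sub>1]\<close> every element of \<open>u\<^sub>n\<close> acts as a multiple \<open>c\<partial>\<^sub>1\<close> with \<open>c \<in> K\<close>, which does not raise degrees.\<close>

lemma lie_ideal_I_ideal:
  assumes n: "2 \<le> n"
  shows "lie_ideal class_ring (u_alg n :: ('a::field, _) lie_alg) (I_ideal n s)"
proof -
  have n1: "1 \<le> n" using n by simp
  note P = x1_polys_subset[OF n]
  have "submodule class_ring (I_ideal n s) (u_alg n :: ('a::field, _) lie_alg)"
    unfolding submodule_u_alg_iff I_ideal_eq
  proof (intro conjI ballI allI)
    show "vfield n n ` x1_polys s \<subseteq> (u_sub n 1 :: ('a mpoly \<Rightarrow> _) set)"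
      using vfield_u[OF n1 order_refl P] by blast
    show "(\<lambda>f. 0) \<in> vfield n n ` (x1_polys s :: 'a mpoly set)"
      unfolding vfield_linear(3)[of n n, symmetric] by (intro imageI x1_polys_closed)
  next
    fix D E :: "'a mpoly \<Rightarrow> 'a mpoly" assume "D \<in> vfield n n ` x1_polys s" "E \<in> vfield n n ` x1_polys s"
    then obtain p q where "D = vfield n n p" "p \<in> x1_polys s" "E = vfield n n q" "q \<in> x1_polys s" by blast
    then show "(\<lambda>f. D f + E f) \<in> vfield n n ` x1_polys s"
      using x1_polys_closed(2)[of p s q] by (simp add: vfield_linear(1)[symmetric])
  next
    fix c and D :: "'a mpoly \<Rightarrow> 'a mpoly" assume "D \<in> vfield n n ` x1_polys s"
    then obtain p where "D = vfield n n p" "p \<in> x1_polys s" by blast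
    then show "(\<lambda>f. Const c * D f) \<in> vfield n n ` x1_polys s"
      using x1_polys_closed(3)[of p s c] by (simp add: vfield_linear(2)[symmetric])
  qed
  moreover have "commutator D E \<in> I_ideal n s"
    if D: "D \<in> u_sub n 1" and E: "E \<in> I_ideal n s" for D E :: "'a mpoly \<Rightarrow> 'a mpoly"
  proof -
    obtain q where q: "E = vfield n n q" "q \<in> x1_polys s" using E by (auto simp: I_ideal_eq)
    have "D (Var 1) \<in> polys 0" using D n1 unfolding u_sub_iff[OF order_refl] by force
    then obtain c where c: "D (Var 1) = Const c" using polys_0_Const by blast
    have "D q = Const c * pdiff 1 q"
      using u_sub_apply_x1[OF D n1, of q] q(2) c by (simp add: x1_polys_def)
    moreover have "q \<in> x1_polys (Suc s)" using q(2) x1_polys_closed(5)[of s "Suc s", where ?'a='a] by auto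
    ultimately have "D q \<in> x1_polys s" by (simp add: x1_polys_closed(3,4))
    then show ?thesis
      unfolding q(1) commutator_vfield_last[OF n1 D P[OF q(2)]] I_ideal_eq by blast
  qed
  ultimately show ?thesis by (simp add: lie_ideal_u_iff)
qed

lemma I_ideal_strict_mono:
  assumes "1 \<le> n"
  shows "I_ideal n s \<subset> (I_ideal n (Suc s) :: ('a::comm_ring_1 mpoly \<Rightarrow> _) set)"
proof -
  let ?q = "Var 1 ^ s :: 'a mpoly"
  have "?q \<in> x1_polys (Suc s)"
    by (auto simp: x1_polys_def intro!: polys_power polys_Var) (simp add: Var_power)
  moreover have "?q \<notin> x1_polys s" by (simp add: x1_polys_def Var_power)
  ultimately have "vfield n n ?q \<in> I_ideal n (Suc s)" "vfield n n ?q \<notin> I_ideal n s"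
    using vfield_eq_iff[OF assms, where ?'a='a] by (auto simp: I_ideal_eq)
  moreover have "I_ideal n s \<subseteq> (I_ideal n (Suc s) :: ('a mpoly \<Rightarrow> _) set)"
    using x1_polys_closed(5)[of s "Suc s", where ?'a='a] by (auto simp: I_ideal_eq)
  ultimately show ?thesis by blast
qed

lemma K_partial_eq_I_ideal: "K_partial n = I_ideal n 1"
  by (auto simp: K_partial_def I_ideal_def One_nat_def)

text \<open>The \<open>s\<close> generators \<open>x\<^sub>1\<^sup>i\<partial>\<^sub>n\<close> bound the dimension from above, the chain
  \<open>I\<^sub>0 \<subset> \<cdots> \<subset> I\<^sub>s\<close> bounds it from below.\<close>

lemma I_ideal_dim:
  assumes n: "2 \<le> n"
  shows "finite_dim_in class_ring (u_alg n :: ('a::field, _) lie_alg) (I_ideal n s)"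
    and "vectorspace.dim class_ring ((u_alg n :: ('a::field, _) lie_alg)\<lparr>carrier := I_ideal n s\<rparr>) = s"
proof -
  let ?L = "u_alg n :: ('a::field, _) lie_alg"
  let ?W = "?L\<lparr>carrier := I_ideal n s\<rparr>"
  have sub: "submodule class_ring (I_ideal n s) ?L" for s
    using lie_ideal_I_ideal[OF n, of s, where ?'a='a] by (simp add: lie_ideal_def)
  interpret V: vectorspace class_ring ?L by (rule vectorspace_u)
  interpret W: vectorspace class_ring ?W
    by (intro V.subspace_is_vs subspace.intro vectorspace_u sub)
  define e :: "nat \<Rightarrow> 'a mpoly \<Rightarrow> 'a mpoly" where "e i = vfield n n (Var 1 ^ i)" for i
  have e: "e i \<in> I_ideal n s" if "i < s" for i
    using that unfolding e_def I_ideal_eq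
    by (intro imageI) (auto simp: x1_polys_def Var_power polys_def)
  let ?A = "e ` {..<s}"
  have A: "?A \<subseteq> carrier ?W" using e by auto
  have S: "submodule class_ring (W.span ?A) ?W" by (rule W.span_is_submodule[OF A])
  have "(\<lambda>f. \<Sum>i<t. Const (c i) * Var 1 ^ i * \<partial> n n f) \<in> W.span ?A" if "t \<le> s" for t and c :: "nat \<Rightarrow> 'a"
    using that
  proof (induction t)
    case 0
    then show ?case using submodule.zero_closed[OF S] by (simp add: u_alg_simps)
  next
    case (Suc t)
    have "e t \<in> W.span ?A" using W.in_own_span[OF A] Suc.prems by auto
    then have "c t \<odot>\<^bsub>?W\<^esub> e t \<in> W.span ?A" by (intro submodule.smult_closed[OF S]) auto
    then have "(\<lambda>f. \<Sum>i<t. Const (c i) * Var 1 ^ i * \<partial> n n f) \<oplus>\<^bsub>?W\<^esub> (c t \<odot>\<^bsub>?W\<^esub> e t) \<in> W.span ?A"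
      using Suc by (intro submodule.m_closed[OF S]) auto
    then show ?case by (simp add: u_alg_simps e_def vfield_def mult.assoc)
  qed
  then have "I_ideal n s \<subseteq> W.span ?A" by (auto simp: I_ideal_def)
  then have gen: "W.span ?A = carrier ?W" using W.span_is_subset2[OF A] by auto
  show fin: "finite_dim_in class_ring ?L (I_ideal n s)"
    unfolding finite_dim_in_def W.fin_dim_def using A gen by blast
  have "W.dim \<le> card ?A" by (rule W.gen_ge_dim[OF _ A gen]) simp
  also have "\<dots> \<le> s" using card_image_le[of "{..<s}" e] by simp
  finally have "W.dim \<le> s" .
  moreover have "s \<le> W.dim"
  proof (rule strict_chain_in_submodule[OF vectorspace_u sub fin, of s "I_ideal n", OF sub])
    show "I_ideal n k \<subseteq> (I_ideal n s :: ('a mpoly \<Rightarrow> _) set)" if "k \<le> s" for k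
      using x1_polys_closed(5)[OF that, where ?'a='a] by (auto simp: I_ideal_eq)
    show "I_ideal n k \<subset> (I_ideal n (Suc k) :: ('a mpoly \<Rightarrow> _) set)" for k
      using n by (intro I_ideal_strict_mono) simp
  qed
  ultimately show "W.dim = s" by simp
qed

context u_ideal
begin

text \<open>If \<open>q\<close> has degree \<open>d\<close>, then \<open>\<partial>\<^sub>1q\<close> has degree \<open>d - 1\<close>, so by induction \<open>I\<^sub>d \<subseteq> I\<close>; a polynomial
  of degree at most \<open>d\<close> differs from a multiple of \<open>q\<close> by one of degree less than \<open>d\<close>.\<close>

lemma I_ideal_Suc_subset:
  assumes n: "2 \<le> n"
  shows "q \<in> x1_polys (Suc d) \<Longrightarrow> Poly_Mapping.lookup q (Poly_Mapping.single 1 d) \<noteq> 0 \<Longrightarrow>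
    vfield n n q \<in> I \<Longrightarrow> I_ideal n (Suc d) \<subseteq> I"
proof (induction d arbitrary: q)
  have n1: "1 \<le> n" using n by simp
  have step: "I_ideal n (Suc d) \<subseteq> I"
    if q: "q \<in> x1_polys (Suc d)" "Poly_Mapping.lookup q (Poly_Mapping.single 1 d) \<noteq> 0" "vfield n n q \<in> I"
      and Id: "I_ideal n d \<subseteq> I" for d q
  proof -
    have "vfield n n p \<in> I" if p: "p \<in> x1_polys (Suc d)" for p
    proof -
      \<comment> \<open>The choice of \<open>b\<close> cancels the coefficient of \<open>x\<^sub>1\<^sup>d\<close> in \<open>r\<close>.\<close>
      define b where "b = Poly_Mapping.lookup p (Poly_Mapping.single 1 d) /
        Poly_Mapping.lookup q (Poly_Mapping.single 1 d)"
      define r where "r = p + Const (- b) * q"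
      have r: "r \<in> x1_polys (Suc d)" unfolding r_def by (intro x1_polys_closed p q)
      have "Poly_Mapping.lookup m 1 < d" if m: "m \<in> Poly_Mapping.keys r" for m
      proof -
        have "Poly_Mapping.lookup m 1 \<noteq> d"
        proof
          assume "Poly_Mapping.lookup m 1 = d"
          then have "m = Poly_Mapping.single 1 d" using x1_monomial[of r m] r m by (auto simp: x1_polys_def)
          then have "Poly_Mapping.lookup r m = 0"
            using q(2) by (simp add: r_def lookup_add lookup_Const_mult b_def)
          then show False using m by (simp add: in_keys_iff)
        qed
        then show ?thesis using r m by (auto simp: x1_polys_def less_Suc_eq)
      qed
      then have "r \<in> x1_polys d" using r by (simp add: x1_polys_def)
      then have "vfield n n r \<in> I" using Id by (auto simp: I_ideal_eq)
      then have "(\<lambda>f. vfield n n r f + Const b * vfield n n q f) \<in> I" by (intro add smult q)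
      moreover have "p = r + Const b * q" by (simp add: r_def single_uminus)
      ultimately show ?thesis by (simp add: vfield_linear)
    qed
    then show ?thesis by (auto simp: I_ideal_eq)
  qed
  {
    case 0
    then show ?case using step[of q 0] zero by (simp add: I_ideal_eq x1_polys_0 vfield_linear)
  next
    case (Suc d)
    have D: "vfield n 1 (1 :: 'a mpoly) \<in> u_sub n 1" using n1 by (intro vfield_u polys_1) auto
    have qn: "q \<in> polys (n - 1)" by (rule x1_polys_subset[OF n Suc.prems(1)])
    then have "q \<in> polys n" using polys_mono[of "n - 1" n] by auto
    then have "vfield n 1 1 q = pdiff 1 q" by (simp add: vfield_apply)
    then have "vfield n n (pdiff 1 q) \<in> I"
      using commutator_right[OF D Suc.prems(3)] commutator_vfield_last[OF n1 D qn] by simp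
    moreover have "pdiff 1 q \<in> x1_polys (Suc d)" by (rule x1_polys_closed(4)[OF Suc.prems(1)])
    moreover have "Poly_Mapping.lookup (pdiff 1 q) (Poly_Mapping.single 1 d) \<noteq> 0"
      using Suc.prems(2) by (simp add: lookup_pdiff single_add[symmetric] One_nat_def del: of_nat_Suc)
    ultimately have "I_ideal n (Suc d) \<subseteq> I" by (intro Suc.IH)
    then show ?case by (rule step[OF Suc.prems])
  }
qed

text \<open>For \<open>E \<in> I\<close> and \<open>j < n\<close>, the elements \<open>[E, x\<^sub>j\<^sup>k\<^sup>+\<^sup>1\<partial>\<^sub>n] = (k + 1) x\<^sub>j\<^sup>k E(x\<^sub>j)\<partial>\<^sub>n\<close> of \<open>I\<close> show
  \<open>E x\<^sub>j = 0\<close>. So \<open>E = q\<partial>\<^sub>n\<close>, and for \<open>2 \<le> i < n\<close> the elements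
  \<open>[x\<^sub>1\<^sup>k\<partial>\<^sub>i, q\<partial>\<^sub>n] = x\<^sub>1\<^sup>k\<partial>\<^sub>i(q)\<partial>\<^sub>n\<close> show \<open>\<partial>\<^sub>iq = 0\<close>.\<close>

lemma finite_dim_imp_x1:
  assumes n: "2 \<le> n" and fin: "finite_dim_in class_ring (u_alg n) I" and E: "E \<in> I"
  shows "\<exists>q\<in>polys 1. E = vfield n n q"
proof -
  have n1: "1 \<le> n" using n by simp
  note Eu = subset[OF E]
  have "E (Var j) = 0" if j: "1 \<le> j" "j < n" for j
  proof -
    have "vfield n n (Var j ^ k * E (Var j)) \<in> I" for k
    proof -
      have x: "Var j \<in> polys (n - 1)" using j by (intro polys_Var) auto
      have "vfield n n (E (Var j ^ Suc k)) \<in> I"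
        using commutator_left[OF E vfield_u[OF n1 order_refl polys_power[OF x]]]
          commutator_vfield_last[OF n1 Eu polys_power[OF x]] by metis
      moreover have "E (Var j ^ Suc k) = Const (of_nat (Suc k)) * (Var j ^ k * E (Var j))"
        using derivation_power[OF u_sub_derivation[OF Eu] polys_Var[of j n], of k] j
        by (simp add: mult.assoc del: of_nat_Suc power_Suc)
      ultimately have "vfield n n (Const (of_nat (Suc k)) * (Var j ^ k * E (Var j))) \<in> I" by simp
      from smult[OF this, of "1 / of_nat (Suc k)"] show ?thesis
        unfolding vfield_linear(2)[symmetric] mult.assoc[symmetric] mult_single
        by (simp add: mult.assoc del: of_nat_Suc)
    qed
    then show ?thesis by (rule finite_dim_no_powers[OF n1 fin])
  qed
  then have "E \<in> u_sub n n" using u_sub_lastI[OF n1 Eu] by blast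
  then obtain q where q: "E = vfield n n q" "q \<in> polys (n - 1)" using u_sub_last[OF n1] by blast
  have pdiff_0: "pdiff i q = 0" if i: "2 \<le> i" "i < n" for i
  proof -
    have "vfield n n (Var 1 ^ k * pdiff i q) \<in> I" for k
    proof -
      have "(Var 1 :: 'a mpoly) ^ k \<in> polys (i - 1)" using i by (intro polys_power polys_Var) auto
      then have D: "vfield n i (Var 1 ^ k :: 'a mpoly) \<in> u_sub n 1" using i by (intro vfield_u) auto
      have "q \<in> polys n" using q(2) polys_mono[of "n - 1" n] by auto
      then have "vfield n i (Var 1 ^ k) q = Var 1 ^ k * pdiff i q" by (simp add: vfield_apply)
      then show ?thesis
        using commutator_right[OF D E] commutator_vfield_last[OF n1 D q(2)] q(1) by simp
    qed
    then show ?thesis by (rule finite_dim_no_powers[OF n1 fin])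
  qed
  have "Poly_Mapping.keys m \<subseteq> {1..1}" if "m \<in> Poly_Mapping.keys q" for m
  proof
    fix i assume i: "i \<in> Poly_Mapping.keys m"
    have "i \<in> {1..n - 1}" using q(2) that i unfolding polys_def by blast
    then have "1 \<le> i" "i \<le> n - 1" by auto
    then show "i \<in> {1..1}"
      using pdiff_nonzero[OF that i] pdiff_0[of i] n
      by (cases "2 \<le> i") auto
  qed
  then show ?thesis using q(1) by (auto simp: polys_def)
qed

text \<open>The \<open>I\<^sub>s\<close> form a strict chain, so there is a last one inside \<open>I\<close>. An element of \<open>I\<close> of degree
  \<open>d \<ge> s\<close> would bring \<open>I\<^bsub>d+1\<^esub> \<supseteq> I\<^bsub>s+1\<^esub>\<close> into \<open>I\<close>.\<close>

lemma finite_dim_imp_I_ideal: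
  assumes n: "2 \<le> n" and fin: "finite_dim_in class_ring (u_alg n) I" and nz: "I \<noteq> {\<lambda>f. 0}"
  shows "\<exists>s\<ge>1. I = I_ideal n s"
proof -
  have n1: "1 \<le> n" using n by simp
  have mono: "I_ideal n s \<subseteq> (I_ideal n t :: ('a mpoly \<Rightarrow> _) set)" if "s \<le> t" for s t
    using x1_polys_closed(5)[OF that, where ?'a='a] by (auto simp: I_ideal_eq)
  have I0: "I_ideal n 0 = {\<lambda>f. 0 :: 'a mpoly}" by (simp add: I_ideal_eq x1_polys_0 vfield_linear)
  have "\<exists>s. I_ideal n s \<subseteq> I \<and> \<not> I_ideal n (Suc s) \<subseteq> I"
  proof (rule ccontr)
    assume *: "\<not> ?thesis"
    have le: "I_ideal n s \<subseteq> I" for s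
      using * zero by (induction s) (auto simp: I0)
    have "k \<le> vectorspace.dim class_ring ((u_alg n)\<lparr>carrier := I\<rparr>)" for k
      using lie_ideal_I_ideal[OF n, where ?'a='a] I_ideal_strict_mono[OF n1, where ?'a='a]
      by (intro strict_chain_in_submodule[OF vectorspace_u submodule fin, of k "I_ideal n"] le)
        (auto simp: lie_ideal_def)
    then show False using not_less_eq_eq by blast
  qed
  then obtain s where s: "I_ideal n s \<subseteq> I" "\<not> I_ideal n (Suc s) \<subseteq> I" by blast
  have "E \<in> I_ideal n s" if E: "E \<in> I" for E
  proof -
    obtain q where q: "q \<in> polys 1" "E = vfield n n q" using finite_dim_imp_x1[OF n fin E] by blast
    have "q \<in> x1_polys s"
    proof (rule ccontr)
      assume "q \<notin> x1_polys s"
      then obtain m0 where m0: "m0 \<in> Poly_Mapping.keys q" "s \<le> Poly_Mapping.lookup m0 1"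
        using q(1) by (auto simp: x1_polys_def not_less)
      define d where "d = Max ((\<lambda>m. Poly_Mapping.lookup m 1) ` Poly_Mapping.keys q)"
      have le: "Poly_Mapping.lookup m 1 \<le> d" if "m \<in> Poly_Mapping.keys q" for m
        using that unfolding d_def by (intro Max_ge) auto
      have "d \<in> (\<lambda>m. Poly_Mapping.lookup m 1) ` Poly_Mapping.keys q"
        using m0(1) unfolding d_def by (intro Max_in) auto
      then obtain m where m: "m \<in> Poly_Mapping.keys q" "Poly_Mapping.lookup m 1 = d" by auto
      have "I_ideal n (Suc d) \<subseteq> I"
      proof (rule I_ideal_Suc_subset[OF n])
        show "q \<in> x1_polys (Suc d)" using q(1) le by (auto simp: x1_polys_def less_Suc_eq_le)
        show "Poly_Mapping.lookup q (Poly_Mapping.single 1 d) \<noteq> 0"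
          using x1_monomial[OF q(1) m(1)] m by (simp add: in_keys_iff)
        show "vfield n n q \<in> I" using E q(2) by simp
      qed
      moreover have "Suc s \<le> Suc d" using m0 le[of m0] by simp
      ultimately show False using s(2) mono by blast
    qed
    then show ?thesis by (simp add: I_ideal_eq q(2))
  qed
  then have "I = I_ideal n s" using s(1) by blast
  moreover from this have "s \<noteq> 0" using nz I0 by auto
  ultimately show ?thesis by (intro exI[of _ s]) auto
qed

end

section \<open>The quotient by the largest proper ideal\<close>

lemma lie_ideal_u_sub:
  "1 \<le> i \<Longrightarrow> lie_ideal class_ring (u_alg n :: ('a::field, _) lie_alg) (u_sub n i)"
  by (simp add: lie_ideal_u_iff submodule_u_sub u_sub_commutator)

lemma u_sub_2_strict:
  assumes n: "1 \<le> n"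
  shows "u_sub n 2 \<subset> (u_sub n 1 :: ('a::comm_ring_1 mpoly \<Rightarrow> _) set)"
proof -
  have "vfield n 1 (1 :: 'a mpoly) \<in> u_sub n 1" using n by (intro vfield_u_sub polys_1) auto
  moreover have "vfield n 1 (1 :: 'a mpoly) \<notin> u_sub n 2"
  proof
    assume "vfield n 1 (1 :: 'a mpoly) \<in> u_sub n 2"
    then have "vfield n 1 (1 :: 'a mpoly) (Var 1) = 0" using n by (simp add: u_sub_iff)
    then show False using n by (simp add: vfield_Var)
  qed
  ultimately show ?thesis using u_sub_mono[of 1 2 n, where ?'a='a] by auto
qed

text \<open>The coset of \<open>\<partial>\<^sub>1\<close> spans: subtracting \<open>x(x\<^sub>1)\<partial>\<^sub>1\<close>, where \<open>x(x\<^sub>1) \<in> P\<^sub>0 = K\<close>, moves \<open>x \<in> u\<^sub>n\<close> into \<open>u\<^bsub>n,2\<^esub>\<close>.\<close>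

lemma quot_u_sub_2:
  assumes n: "1 \<le> n"
  shows "cofinite_in class_ring (u_alg n :: ('a::field, _) lie_alg) (u_sub n 2)"
    and "vectorspace.dim class_ring (quot_vs (u_alg n :: ('a::field, _) lie_alg) (u_sub n 2)) = 1"
proof -
  let ?L = "u_alg n :: ('a::field, _) lie_alg"
  let ?Q = "quot_vs ?L (u_sub n 2)"
  have W: "submodule class_ring (u_sub n 2) ?L" by (rule submodule_u_sub) simp
  interpret V: vectorspace class_ring ?L by (rule vectorspace_u)
  interpret Q: vectorspace class_ring ?Q by (rule vectorspace_quot[OF vectorspace_u W])
  interpret S: abelian_subgroup "u_sub n 2" ?L by (rule V.submodule_abelian_subgroup[OF W])
  note co = coset_operations[OF vectorspace_u W]
  define D :: "'a mpoly \<Rightarrow> 'a mpoly" where "D = vfield n 1 1"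
  have D: "D \<in> u_sub n 1" using n unfolding D_def by (intro vfield_u_sub polys_1) auto
  have D1: "D (Var 1) = 1" using n by (simp add: D_def vfield_Var)
  let ?d = "u_sub n 2 +>\<^bsub>?L\<^esub> D"
  have d: "{?d} \<subseteq> carrier ?Q" using co(1)[of D] D by (simp add: u_alg_simps)
  have "X \<in> Q.span {?d}" if X: "X \<in> carrier ?Q" for X
  proof -
    obtain x where x: "x \<in> u_sub n 1" "X = u_sub n 2 +>\<^bsub>?L\<^esub> x"
      using co(5)[OF X] by (auto simp: u_alg_simps)
    have "x (Var 1) \<in> polys 0" using x(1) n unfolding u_sub_iff[OF order_refl] by force
    then obtain b where b: "x (Var 1) = Const b" using polys_0_Const by blast
    have bD: "(\<lambda>f. Const b * D f) \<in> u_sub n 1"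
      using submodule.smult_closed[OF submodule_u_sub[OF order_refl, of n, where ?'a='a] _ D, of b]
      by (simp add: u_alg_simps)
    define y where "y = (\<lambda>f. x f - Const b * D f)"
    have y1: "y \<in> u_sub n 1" unfolding y_def by (rule u_sub_diff[OF order_refl x(1) bD])
    have "y (Var j) = 0" if "1 \<le> j" "j < 2" for j
    proof -
      have "j = 1" using that by simp
      then show ?thesis by (simp add: y_def b D1)
    qed
    then have "y \<in> u_sub n 2" using y1 by (auto simp: u_sub_iff)
    moreover have "x = y \<oplus>\<^bsub>?L\<^esub> (b \<odot>\<^bsub>?L\<^esub> D)" by (simp add: u_alg_simps y_def)
    ultimately have "x \<in> u_sub n 2 +>\<^bsub>?L\<^esub> (b \<odot>\<^bsub>?L\<^esub> D)" unfolding a_r_coset_def' by blast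
    then have "u_sub n 2 +>\<^bsub>?L\<^esub> (b \<odot>\<^bsub>?L\<^esub> D) = X"
      unfolding x(2) by (rule S.a_repr_independence') (use bD in \<open>simp_all add: u_alg_simps\<close>)
    then have "X = b \<odot>\<^bsub>?Q\<^esub> ?d" using co(3)[of b D] D by (simp add: u_alg_simps)
    moreover have "?d \<in> Q.span {?d}" using Q.in_own_span[OF d] by simp
    ultimately show ?thesis
      using submodule.smult_closed[OF Q.span_is_submodule[OF d], of b ?d] by simp
  qed
  then have gen: "Q.span {?d} = carrier ?Q" using Q.span_is_subset2[OF d] by auto
  show cofin: "cofinite_in class_ring ?L (u_sub n 2)"
    unfolding cofinite_in_def Q.fin_dim_def using d gen by blast
  have "Q.dim \<le> card {?d}" by (rule Q.gen_ge_dim[OF _ d gen]) simp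
  moreover have "1 \<le> Q.dim"
  \<comment> \<open>The chain is \<open>u\<^bsub>n,2\<^esub> \<subset> u\<^sub>n\<close>.\<close>
  proof (rule strict_chain_mod_submodule[OF vectorspace_u W cofin, of 1 "\<lambda>k. u_sub n (2 - k)"])
    show "submodule class_ring (u_sub n (2 - k)) ?L" if "k \<le> 1" for k
      using that by (intro submodule_u_sub) simp
    show "u_sub n 2 \<subseteq> (u_sub n (2 - k) :: ('a mpoly \<Rightarrow> _) set)" if "k \<le> 1" for k
      using that by (intro u_sub_mono) auto
    show "u_sub n (2 - k) \<subset> (u_sub n (2 - Suc k) :: ('a mpoly \<Rightarrow> _) set)" if "k < 1" for k
      using that u_sub_2_strict[OF n, where ?'a='a] by (simp add: One_nat_def)
  qed
  ultimately show "Q.dim = 1" by simp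
qed

theorem corollary3p4:
  fixes n :: nat
    and K :: "'a::field_char_0 ring"
    and L :: "('a, 'a mpoly \<Rightarrow> 'a mpoly) lie_alg"
  defines "K \<equiv> class_ring" and "L \<equiv> u_alg n"
  assumes "n \<ge> 2"
  shows
    "(proper_lie_ideal K L (u_sub n 2) \<and> (\<forall>I. proper_lie_ideal K L I \<longrightarrow> I \<subseteq> u_sub n 2))
   \<and> ({I. proper_lie_ideal K L I \<and> cofinite_in K L I} = {u_sub n 2}
      \<and> vectorspace.dim K (quot_vs L (u_sub n 2)) = 1)
   \<and> (lie_centre L = K_partial n
      \<and> lie_ideal K L (lie_centre L) \<and> lie_centre L \<noteq> {\<zero>\<^bsub>L\<^esub>}
      \<and> (\<forall>I. lie_ideal K L I \<and> I \<noteq> {\<zero>\<^bsub>L\<^esub>} \<longrightarrow> lie_centre L \<subseteq> I))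
   \<and> ({I. lie_ideal K L I \<and> I \<noteq> {\<zero>\<^bsub>L\<^esub>} \<and> finite_dim_in K L I} = {I_ideal n s | s. s \<ge> 1}
      \<and> (\<forall>s\<ge>1. vectorspace.dim K (L\<lparr>carrier := I_ideal n s\<rparr>) = s))"
proof -
  have n1: "1 \<le> n" using \<open>n \<ge> 2\<close> by simp
  have zero: "\<zero>\<^bsub>L\<^esub> = (\<lambda>f. 0)" and carrier: "carrier L = u_sub n 1"
    by (simp_all add: L_def u_alg_simps)
  have nonzero: "I_ideal n s \<noteq> {\<lambda>f. 0 :: 'a mpoly}" if "1 \<le> s" for s
  proof -
    have "I_ideal n 0 = {\<lambda>f. 0 :: 'a mpoly}" by (simp add: I_ideal_eq x1_polys_0 vfield_linear)
    moreover have "I_ideal n 1 \<subseteq> (I_ideal n s :: ('a mpoly \<Rightarrow> _) set)"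
      using x1_polys_closed(5)[OF that, where ?'a='a] by (auto simp: I_ideal_eq)
    ultimately show ?thesis
      using I_ideal_strict_mono[OF n1, of 0, where ?'a='a] by (auto simp: One_nat_def)
  qed
  have centre: "lie_centre L = K_partial n" unfolding L_def by (rule centre_eq_K_partial[OF n1])
  have least: "K_partial n \<subseteq> I" if "lie_ideal K L I" "I \<noteq> {\<lambda>f. 0}" for I
    using u_ideal.K_partial_subset[OF u_ideal.intro n1] that by (simp add: K_def L_def)
  have I_ideal: "lie_ideal K L (I_ideal n s)" for s
    unfolding K_def L_def by (rule lie_ideal_I_ideal[OF \<open>n \<ge> 2\<close>])
  have K_ideal: "lie_ideal K L (K_partial n)" "K_partial n \<noteq> {\<lambda>f. 0 :: 'a mpoly}"
    using I_ideal[of 1] nonzero[of 1] by (simp_all add: K_partial_eq_I_ideal)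
  have u2: "lie_ideal K L (u_sub n 2)" unfolding K_def L_def by (rule lie_ideal_u_sub) simp
  have u2_nonzero: "u_sub n 2 \<noteq> {\<lambda>f. 0 :: 'a mpoly}"
  proof -
    have "vfield n n (1 :: 'a mpoly) \<in> u_sub n n" using n1 by (intro vfield_u_sub polys_1) auto
    then have "vfield n n (1 :: 'a mpoly) \<in> u_sub n 2"
      using u_sub_mono[of 2 n n, where ?'a='a] \<open>n \<ge> 2\<close> by auto
    moreover have "vfield n n (1 :: 'a mpoly) \<noteq> (\<lambda>f. 0)" using vfield_eq_0_iff[OF n1, of "1 :: 'a mpoly"] by simp
    ultimately show ?thesis by blast
  qed
  have proper: "proper_lie_ideal K L (u_sub n 2)"
    using u2 u2_nonzero u_sub_2_strict[OF n1, where ?'a='a] by (auto simp: proper_lie_ideal_def zero carrier)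
  have largest: "I \<subseteq> u_sub n 2" if "proper_lie_ideal K L I" for I
    using that u_ideal.eq_u_sub_1[OF u_ideal.intro n1, of I]
    by (auto simp: proper_lie_ideal_def carrier K_def L_def u_alg_simps(1))
  have cofinite: "I = u_sub n 2" if "proper_lie_ideal K L I" "cofinite_in K L I" for I
    using u_ideal.cofinite_imp_u_sub_2_subset[OF u_ideal.intro n1, of I] largest[OF that(1)] that
    by (simp add: proper_lie_ideal_def K_def L_def)
  have finite: "\<exists>s\<ge>1. I = I_ideal n s"
    if "lie_ideal K L I" "I \<noteq> {\<lambda>f. 0}" "finite_dim_in K L I" for I
    using u_ideal.finite_dim_imp_I_ideal[OF u_ideal.intro \<open>n \<ge> 2\<close>, of I] that by (simp add: K_def L_def)
  have finite_I: "finite_dim_in K L (I_ideal n s)" for s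
    unfolding K_def L_def by (rule I_ideal_dim(1)[OF \<open>n \<ge> 2\<close>])
  have dim_I: "\<forall>s\<ge>1. vectorspace.dim K (L\<lparr>carrier := I_ideal n s\<rparr>) = s"
    unfolding K_def L_def by (intro allI impI I_ideal_dim(2) \<open>n \<ge> 2\<close>)
  have cofinite_u2: "cofinite_in K L (u_sub n 2)" "vectorspace.dim K (quot_vs L (u_sub n 2)) = 1"
    unfolding K_def L_def by (rule quot_u_sub_2[OF n1])+
  have finite_set: "{I. lie_ideal K L I \<and> I \<noteq> {\<lambda>f. 0} \<and> finite_dim_in K L I} = {I_ideal n s | s. s \<ge> 1}"
  proof (intro equalityI subsetI)
    fix I assume "I \<in> {I. lie_ideal K L I \<and> I \<noteq> {\<lambda>f. 0} \<and> finite_dim_in K L I}"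
    then obtain s where "1 \<le> s" "I = I_ideal n s" using finite[of I] by auto
    then show "I \<in> {I_ideal n s | s. s \<ge> 1}" by blast
  next
    fix I :: "('a mpoly \<Rightarrow> 'a mpoly) set" assume "I \<in> {I_ideal n s | s. s \<ge> 1}"
    then obtain s where s: "1 \<le> s" "I = I_ideal n s" by blast
    show "I \<in> {I. lie_ideal K L I \<and> I \<noteq> {\<lambda>f. 0} \<and> finite_dim_in K L I}"
      unfolding s(2) using I_ideal[of s] nonzero[OF s(1)] finite_I[of s] by simp
  qed
  have cofinite_set: "{I. proper_lie_ideal K L I \<and> cofinite_in K L I} = {u_sub n 2}"
  proof (intro equalityI subsetI)
    fix I assume "I \<in> {I. proper_lie_ideal K L I \<and> cofinite_in K L I}"
    then show "I \<in> {u_sub n 2}" using cofinite[of I] by simp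
  next
    fix I assume "I \<in> {u_sub n 2 :: ('a mpoly \<Rightarrow> 'a mpoly) set}"
    then show "I \<in> {I. proper_lie_ideal K L I \<and> cofinite_in K L I}"
      using proper cofinite_u2(1) by simp
  qed
  show ?thesis
    unfolding zero centre
  proof (intro conjI)
    show "\<forall>I. proper_lie_ideal K L I \<longrightarrow> I \<subseteq> u_sub n 2" by (intro allI impI largest)
    show "\<forall>I. lie_ideal K L I \<and> I \<noteq> {\<lambda>f. 0} \<longrightarrow> K_partial n \<subseteq> I"
      by (intro allI impI least) (erule conjunct1 conjunct2)+
  qed (rule proper cofinite_set cofinite_u2(2) K_ideal refl finite_set dim_I)+
qed

end
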